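(* Let $\mathbb{F}$ be a finite rank, non-abelian free group. The action of $\mathbb{F}\times\mathbb{F}$ on the universal cover of its Salvetti complex is growth tight with respect to the piecewise Euclidean metric, but is not growth tight with respect to the 1-skeleton metric.
   Context: The group $\mathbb{F}\times\mathbb{F}$ is viewed as the right angled Artin group whose defining graph is the join of two (edgeless) sets of vertices, each of cardinality equal to the rank of $\mathbb{F}$. The universal cover of its Salvetti complex is the product $T\times T$ of two copies of the Cayley graph $T$ (a tree) of $\mathbb{F}$ with respect to a free generating set, with $\mathbb{F}\times\mathbb{F}$ acting coordinate-wise by left multiplication. Two metrics on the vertex set of this complex are considered: the piecewise Euclidean metric (the length metric of the square complex with unit Euclidean squares), which is the restriction of the $L^2$ product metric $\sqrt{d_1^2+d_2^2}$ on $T\times T$; and the 1-skeleton metric (the induced length metric in the 1-skeleton), which is the restriction of the $L^1$ product metric $d_1+d_2$. Growth. For a set $A$ with a pseudo-metric $d$ and base point $a_0\in A$, the growth exponent is $\delta_{A,d}=\limsup_{r\to\infty}\frac1r\log\#\{a\in A\mid d(a_0,a)\le r\}$ (independent of the base point). If $G$ acts properly discontinuously and cocompactly by isometries on a proper based geodesic metric space $(X,d,o)$ and $N$ is a normal subgroup of $G$, then $G/N$ carries the left invariant pseudo-metric $\bar d(gN,g'N)=\min_{n,n'\in N}d(gn.o,g'n'.o)$. Write $\delta_{G/N}=\delta_{G/N,\bar d}$ and $\delta_G=\delta_{G/\{1\}}$. The action is growth tight if $\delta_G>\delta_{G/N}$ for every infinite normal subgroup $N$ of $G$. Here $o$ is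 a vertex. *)

theory Defs
  imports "HOL-Algebra.Coset" "HOL-Library.Extended_Real" "HOL-Library.Liminf_Limsup" Complex_Main
begin

section \<open>Free groups\<close>

definition letter_value :: "('a, 'm) monoid_scheme \<Rightarrow> 'a \<times> bool \<Rightarrow> 'a" where
  "letter_value F = (\<lambda>(s, b). if b then s else inv\<^bsub>F\<^esub> s)"

definition word_value :: "('a, 'm) monoid_scheme \<Rightarrow> ('a \<times> bool) list \<Rightarrow> 'a" where
  "word_value F w = foldr (\<lambda>l g. letter_value F l \<otimes>\<^bsub>F\<^esub> g) w \<one>\<^bsub>F\<^esub>"

definition reduced_words :: "'a set \<Rightarrow> ('a \<times> bool) list set" where
  "reduced_words S =
     {w \<in> lists (S \<times> UNIV). successively (\<lambda>(s, b) (t, c). \<not> (s = t \<and> b \<noteq> c)) w}"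

definition free_basis :: "('a, 'm) monoid_scheme \<Rightarrow> 'a set \<Rightarrow> bool" where
  "free_basis F S \<longleftrightarrow>
     group F \<and> S \<subseteq> carrier F \<and> bij_betw (word_value F) (reduced_words S) (carrier F)"

section \<open>Growth tight actions\<close>

definition log_count :: "'a set \<Rightarrow> ereal" where
  "log_count B = (if finite B then ereal (ln (real (card B))) else \<infinity>)"

definition growth_exponent :: "'a set \<Rightarrow> ('a \<Rightarrow> 'a \<Rightarrow> real) \<Rightarrow> 'a \<Rightarrow> ereal" where
  "growth_exponent A d a\<^sub>0 =
     Limsup at_top (\<lambda>r :: real. log_count {a \<in> A. d a\<^sub>0 a \<le> r} / ereal r)"

text \<open>
  Pseudo-metric on cosets \<open>C = g N\<close> and \<open>C' = g' N\<close>. For a properly discontinuous action on a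
  proper space the infimum is a minimum.
\<close>

definition coset_dist ::
  "('g \<Rightarrow> 'x \<Rightarrow> 'x) \<Rightarrow> ('x \<Rightarrow> 'x \<Rightarrow> real) \<Rightarrow> 'x \<Rightarrow> 'g set \<Rightarrow> 'g set \<Rightarrow> real" where
  "coset_dist \<phi> d p C C' = Inf {d (\<phi> c p) (\<phi> c' p) | c c'. c \<in> C \<and> c' \<in> C'}"

text \<open>
  The elements of \<open>G Mod N\<close> are right cosets, which for normal \<open>N\<close> are also the left cosets;
  its neutral element, the coset \<open>N\<close>, is the base point.
\<close>

definition quotient_growth ::
  "('g, 'm) monoid_scheme \<Rightarrow> ('g \<Rightarrow> 'x \<Rightarrow> 'x) \<Rightarrow> ('x \<Rightarrow> 'x \<Rightarrow> real) \<Rightarrow> 'x \<Rightarrow> 'g set \<Rightarrow> ereal" where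
  "quotient_growth G \<phi> d p N = growth_exponent (carrier (G Mod N)) (coset_dist \<phi> d p) N"

definition growth_tight ::
  "('g, 'm) monoid_scheme \<Rightarrow> ('g \<Rightarrow> 'x \<Rightarrow> 'x) \<Rightarrow> ('x \<Rightarrow> 'x \<Rightarrow> real) \<Rightarrow> 'x \<Rightarrow> bool" where
  "growth_tight G \<phi> d p \<longleftrightarrow>
     (\<forall>N. N \<lhd> G \<and> infinite N \<longrightarrow>
        quotient_growth G \<phi> d p {\<one>\<^bsub>G\<^esub>} > quotient_growth G \<phi> d p N)"

section \<open>Length metrics on cell complexes\<close>

text \<open>
  \<open>R x y l\<close> is to mean that \<open>x\<close> and \<open>y\<close> lie in a common closed cell and have distance \<open>l\<close> in
  that cell. The length metric of the complex is the infimum of the lengths of finite strings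
  of points in which consecutive points share a cell.
\<close>

inductive string_length :: "('x \<Rightarrow> 'x \<Rightarrow> real \<Rightarrow> bool) \<Rightarrow> 'x \<Rightarrow> 'x \<Rightarrow> real \<Rightarrow> bool"
  for R where
  refl: "string_length R x x 0"
| step: "R x y l \<Longrightarrow> string_length R y z m \<Longrightarrow> string_length R x z (l + m)"

definition length_metric :: "('x \<Rightarrow> 'x \<Rightarrow> real \<Rightarrow> bool) \<Rightarrow> 'x \<Rightarrow> 'x \<Rightarrow> real" where
  "length_metric R x y = Inf {l. string_length R x y l}"

section \<open>The product of two Cayley trees\<close>

text \<open>
  Points of the geometric realisation \<open>T\<close> of the Cayley graph of \<open>F\<close> with respect to \<open>S\<close>: the
  vertices, and the points \<open>Interior g s t\<close> with \<open>0 < t < 1\<close> at distance \<open>t\<close> from \<open>g\<close> on the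
  open edge from \<open>g\<close> to \<open>g s\<close>, where \<open>s \<in> S\<close>. The function \<open>edge_point F g s\<close> parametrises the
  closed edge by \<open>{0..1}\<close>.
\<close>

datatype 'a tree_point = Vertex 'a | Interior 'a 'a real

definition edge_point :: "('a, 'm) monoid_scheme \<Rightarrow> 'a \<Rightarrow> 'a \<Rightarrow> real \<Rightarrow> 'a tree_point" where
  "edge_point F g s t =
     (if t = 0 then Vertex g else if t = 1 then Vertex (g \<otimes>\<^bsub>F\<^esub> s) else Interior g s t)"

primrec translate :: "('a, 'm) monoid_scheme \<Rightarrow> 'a \<Rightarrow> 'a tree_point \<Rightarrow> 'a tree_point" where
  "translate F k (Vertex g) = Vertex (k \<otimes>\<^bsub>F\<^esub> g)"
| "translate F k (Interior g s t) = Interior (k \<otimes>\<^bsub>F\<^esub> g) s t"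

definition product_action ::
  "('a, 'm) monoid_scheme \<Rightarrow> 'a \<times> 'a \<Rightarrow> 'a tree_point \<times> 'a tree_point \<Rightarrow> 'a tree_point \<times> 'a tree_point"
  where "product_action F = (\<lambda>(k, k') (x, x'). (translate F k x, translate F k' x'))"

text \<open>
  The universal cover of the Salvetti complex of \<open>F \<times> F\<close> is \<open>T \<times> T\<close>: its squares are the
  products of two closed edges of \<open>T\<close>, its edges the products of a closed edge and a vertex.
\<close>

definition square_dist ::
  "('a, 'm) monoid_scheme \<Rightarrow> 'a set \<Rightarrow>
     'a tree_point \<times> 'a tree_point \<Rightarrow> 'a tree_point \<times> 'a tree_point \<Rightarrow> real \<Rightarrow> bool" where
  "square_dist F S x y l \<longleftrightarrow>
     (\<exists>g \<in> carrier F. \<exists>g' \<in> carrier F. \<exists>s \<in> S. \<exists>s' \<in> S.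
      \<exists>a \<in> {0..1}. \<exists>a' \<in> {0..1}. \<exists>b \<in> {0..1}. \<exists>b' \<in> {0..1}.
        x = (edge_point F g s a, edge_point F g' s' a') \<and>
        y = (edge_point F g s b, edge_point F g' s' b') \<and>
        l = sqrt ((a - b)\<^sup>2 + (a' - b')\<^sup>2))"

definition edge_dist ::
  "('a, 'm) monoid_scheme \<Rightarrow> 'a set \<Rightarrow>
     'a tree_point \<times> 'a tree_point \<Rightarrow> 'a tree_point \<times> 'a tree_point \<Rightarrow> real \<Rightarrow> bool" where
  "edge_dist F S x y l \<longleftrightarrow>
     (\<exists>g \<in> carrier F. \<exists>h \<in> carrier F. \<exists>s \<in> S. \<exists>a \<in> {0..1}. \<exists>b \<in> {0..1}.
        l = \<bar>a - b\<bar> \<and>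
        (x = (edge_point F g s a, Vertex h) \<and> y = (edge_point F g s b, Vertex h) \<or>
         x = (Vertex h, edge_point F g s a) \<and> y = (Vertex h, edge_point F g s b)))"

definition piecewise_euclidean_metric ::
  "('a, 'm) monoid_scheme \<Rightarrow> 'a set \<Rightarrow>
     'a tree_point \<times> 'a tree_point \<Rightarrow> 'a tree_point \<times> 'a tree_point \<Rightarrow> real" where
  "piecewise_euclidean_metric F S = length_metric (square_dist F S)"

text \<open>Meaningful for points of the 1-skeleton, i.e. pairs with at least one vertex entry.\<close>

definition one_skeleton_metric ::
  "('a, 'm) monoid_scheme \<Rightarrow> 'a set \<Rightarrow>
     'a tree_point \<times> 'a tree_point \<Rightarrow> 'a tree_point \<times> 'a tree_point \<Rightarrow> real" where
  "one_skeleton_metric F S = length_metric (edge_dist F S)"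

end

theory Submission
  imports Defs "HOL-Real_Asymp.Real_Asymp"
begin

text \<open>
  Let \<open>q = 2 card S - 1\<close>; spheres of radius \<open>n\<close> in \<open>F\<close> have about \<open>q ^ n\<close> elements. For the
  \<open>L\<^sup>1\<close> metric, \<open>F \<times> F\<close> has about \<open>n q ^ n\<close> elements of norm \<open>n\<close>, hence the same growth exponent
  \<open>ln q\<close> as its quotient by the second factor. For the \<open>L\<^sup>2\<close> metric the exponent of \<open>F \<times> F\<close> is
  \<open>sqrt 2 * ln q\<close>. A nontrivial normal subgroup \<open>N\<close> meets one of the factors nontrivially, because
  the centre of \<open>F\<close> is trivial. Shortest representatives of the cosets of a nontrivial normal
  subgroup of \<open>F\<close> avoid a fixed subword, so the quotient of that factor has an exponent
  \<open>a < ln q\<close>, and by Cauchy-Schwarz the exponent of the quotient by \<open>N\<close> is at most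
  \<open>sqrt (a\<^sup>2 + (ln q)\<^sup>2)\<close>.
\<close>

section \<open>Reduced words\<close>

text \<open>Pairs of coordinate lengths with norm at most \<open>r\<close> are polynomially many, so
  the exponent of a product of sets with exponents \<open>a\<close> and \<open>b\<close> is the
  maximum of \<open>a * i + b * j\<close> over pairs \<open>(i, j)\<close> of norm 1, the dual norm
  of \<open>(a, b)\<close>. For L1 this is the maximum of \<open>a\<close> and \<open>b\<close>,
  which need not notice the loss of one factor; for L2 it is
  \<open>sqrt (a\<^sup>2 + b\<^sup>2)\<close>, which drops as soon as one entry drops. A normal
  subgroup \<open>N\<close> need not be a product, but it contains the product of its intersections
  with the factors, so representatives of its cosets can be shortened in each coordinate separately.
  The metrics are only estimated: below by functions that are 1-Lipschitz on every cell, above by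
  explicit strings, which for L2 are needed only along diagonals, since pairs of equal length
  already realise the exponent. The base vertex \<open>(u, v)\<close> is arbitrary; it is handled by
  working with \<open>(u x u^-1, v y v^-1)\<close>, which moves \<open>(u, v)\<close> to
  \<open>(u x, v y)\<close>.\<close>

definition flip :: "'a \<times> bool \<Rightarrow> 'a \<times> bool" where
  "flip = (\<lambda>(s, b). (s, \<not> b))"

lemma flip_flip [simp]: "flip (flip l) = l"
  by (simp add: flip_def split: prod.splits)

lemma flip_in_letters [simp]: "flip l \<in> S \<times> UNIV \<longleftrightarrow> l \<in> S \<times> UNIV"
  by (auto simp: flip_def split: prod.splits)

lemma reduced_words_iff:
  fixes S :: "'a set"
  shows "w \<in> reduced_words S \<longleftrightarrow> w \<in> lists (S \<times> UNIV) \<and> successively (\<lambda>l m. m \<noteq> flip l) w"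
proof -
  have "(\<lambda>(s :: 'a, b) (t, c). \<not> (s = t \<and> b \<noteq> c)) = (\<lambda>l m. m \<noteq> flip l)"
    by (auto simp: flip_def fun_eq_iff)
  then show ?thesis
    by (simp only: reduced_words_def mem_Collect_eq)
qed

lemma Nil_reduced [simp]: "[] \<in> reduced_words S"
  by (simp add: reduced_words_iff)

lemma reduced_Cons:
  "l # w \<in> reduced_words S \<longleftrightarrow>
     l \<in> S \<times> UNIV \<and> w \<in> reduced_words S \<and> (w = [] \<or> hd w \<noteq> flip l)"
  by (cases w) (auto simp: reduced_words_iff)

lemma reduced_append:
  "v @ w \<in> reduced_words S \<longleftrightarrow> v \<in> reduced_words S \<and> w \<in> reduced_words S \<and>
     (v = [] \<or> w = [] \<or> hd w \<noteq> flip (last v))"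
  by (auto simp: reduced_words_iff successively_append_iff)

lemma reduced_in_lists: "w \<in> reduced_words S \<Longrightarrow> w \<in> lists (S \<times> UNIV)"
  by (simp add: reduced_words_iff)

text \<open>Fixing the preceding letter makes the recursion uniform: whatever \<open>l\<close> is,
  exactly one letter is forbidden next, so each step offers \<open>q\<close> choices.\<close>

definition extensions :: "'a set \<Rightarrow> 'a \<times> bool \<Rightarrow> nat \<Rightarrow> ('a \<times> bool) list set" where
  "extensions S l n = {w. length w = n \<and> l # w \<in> reduced_words S}"

definition sphere :: "'a set \<Rightarrow> nat \<Rightarrow> ('a \<times> bool) list set" where
  "sphere S n = {w \<in> reduced_words S. length w = n}"

lemma finite_sphere: "finite S \<Longrightarrow> finite (sphere S n)"
  by (rule finite_subset[OF _ finite_lists_length_eq[of "S \<times> UNIV" n]])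
    (auto simp: sphere_def reduced_words_iff)

lemma finite_extensions: "finite S \<Longrightarrow> finite (extensions S l n)"
  by (rule finite_subset[OF _ finite_sphere[of S n]])
    (auto simp: extensions_def sphere_def reduced_Cons)

lemma card_letters: "finite S \<Longrightarrow> card (S \<times> (UNIV :: bool set)) = 2 * card S"
  by (simp add: card_cartesian_product)

lemma card_extensions:
  assumes "finite S" "l \<in> S \<times> UNIV"
  shows "card (extensions S l n) = (2 * card S - 1) ^ n"
  using assms(2)
proof (induction n arbitrary: l)
  case 0
  then have "extensions S l 0 = {[]}"
    by (auto simp: extensions_def reduced_Cons)
  then show ?case by simp
next
  case (Suc n)
  let ?L = "S \<times> (UNIV :: bool set) - {flip l}"
  have "extensions S l (Suc n) = (\<Union>m \<in> ?L. (#) m ` extensions S m n)"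
  proof (intro equalityI subsetI)
    fix w assume "w \<in> extensions S l (Suc n)"
    then show "w \<in> (\<Union>m \<in> ?L. (#) m ` extensions S m n)"
      by (cases w) (auto simp: extensions_def reduced_Cons)
  qed (use Suc.prems in \<open>auto simp: extensions_def reduced_Cons\<close>)
  then have "card (extensions S l (Suc n)) = (\<Sum>m \<in> ?L. card ((#) m ` extensions S m n))"
    using assms(1) by (subst card_UN_disjoint[symmetric]) (auto simp: finite_extensions)
  also have "\<dots> = (\<Sum>m \<in> ?L. (2 * card S - 1) ^ n)"
    by (intro sum.cong) (auto simp: card_image Suc.IH)
  also have "\<dots> = (2 * card S - 1) ^ Suc n"
  proof -
    have "card ?L = 2 * card S - 1"
      using assms(1) Suc.prems card_letters[of S]
      by (simp only: card_Diff_singleton flip_in_letters)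
    then show ?thesis by simp
  qed
  finally show ?case .
qed

lemma card_sphere_Suc:
  assumes "finite S"
  shows "card (sphere S (Suc n)) = 2 * card S * (2 * card S - 1) ^ n"
proof -
  have "sphere S (Suc n) = (\<Union>l \<in> S \<times> UNIV. (#) l ` extensions S l n)"
  proof (intro equalityI subsetI)
    fix w assume "w \<in> sphere S (Suc n)"
    then show "w \<in> (\<Union>l \<in> S \<times> UNIV. (#) l ` extensions S l n)"
      by (cases w) (auto simp: extensions_def sphere_def reduced_Cons)
  qed (auto simp: extensions_def sphere_def)
  then have "card (sphere S (Suc n)) = (\<Sum>l \<in> S \<times> UNIV. card ((#) l ` extensions S l n))"
    using assms by (subst card_UN_disjoint[symmetric]) (auto simp: finite_extensions)
  also have "\<dots> = (\<Sum>l \<in> S \<times> (UNIV :: bool set). (2 * card S - 1) ^ n)"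
    by (intro sum.cong) (auto simp: card_image card_extensions assms)
  also have "\<dots> = 2 * card S * (2 * card S - 1) ^ n"
    using assms by (simp add: card_letters)
  finally show ?thesis .
qed

lemma sphere_0: "sphere S 0 = {[]}"
  by (auto simp: sphere_def)

text \<open>Only the first letter has \<open>q + 1\<close> choices instead of \<open>q\<close>; the
  factor 2 absorbs this.\<close>

lemma card_sphere_le:
  assumes "finite S" "card S > 0"
  shows "card (sphere S n) \<le> 2 * (2 * card S - 1) ^ n"
proof (cases n)
  case (Suc k)
  have "2 * card S \<le> 2 * (2 * card S - 1)"
    using assms(2) by linarith
  then have "2 * card S * (2 * card S - 1) ^ k \<le> 2 * (2 * card S - 1) * (2 * card S - 1) ^ k"
    by (rule mult_right_mono) simp
  then show ?thesis
    using assms(1) by (simp only: Suc card_sphere_Suc power_Suc mult.assoc)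
qed (simp add: sphere_0)

lemma card_sphere_ge:
  assumes "finite S"
  shows "(2 * card S - 1) ^ n \<le> card (sphere S n)"
  by (cases n) (use assms in \<open>auto simp: sphere_0 card_sphere_Suc\<close>)

section \<open>Reduced words without a given subword\<close>

definition avoids :: "'b list \<Rightarrow> 'b list \<Rightarrow> bool" where
  "avoids w\<^sub>0 w \<longleftrightarrow> (\<nexists>p s. w = p @ w\<^sub>0 @ s)"

lemma avoids_appendD: "avoids w\<^sub>0 (v @ w) \<Longrightarrow> avoids w\<^sub>0 v \<and> avoids w\<^sub>0 w"
  proof -
  have "v @ w = p @ w\<^sub>0 @ (s @ w)" if "v = p @ w\<^sub>0 @ s" for p s
    using that by simp
  moreover have "v @ w = (v @ p) @ w\<^sub>0 @ s" if "w = p @ w\<^sub>0 @ s" for p s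
    using that by simp
  ultimately show "avoids w\<^sub>0 (v @ w) \<Longrightarrow> avoids w\<^sub>0 v \<and> avoids w\<^sub>0 w"
    unfolding avoids_def by blast
qed

text \<open>
  One letter more than the length of the forbidden word is needed: it separates the
  letter before the extension from the forbidden word, so that these do not cancel.
\<close>

lemma card_avoiding_extensions:
  assumes "finite S" "card S \<ge> 2" "w\<^sub>0 \<in> reduced_words S" "w\<^sub>0 \<noteq> []" "l \<in> S \<times> UNIV"
  shows "card {w \<in> extensions S l (Suc (length w\<^sub>0)). avoids w\<^sub>0 w}
           \<le> (2 * card S - 1) ^ Suc (length w\<^sub>0) - 1"
proof -
  have "\<not> S \<times> (UNIV :: bool set) \<subseteq> {flip l, flip (hd w\<^sub>0)}"
  proof
    assume "S \<times> (UNIV :: bool set) \<subseteq> {flip l, flip (hd w\<^sub>0)}"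
    then have "card (S \<times> (UNIV :: bool set)) \<le> card {flip l, flip (hd w\<^sub>0)}"
      by (intro card_mono) auto
    also have "\<dots> \<le> 2"
      by (simp add: card_insert_if)
    finally show False
      using assms(1,2) by (simp add: card_letters)
  qed
  then obtain m where m: "m \<in> S \<times> UNIV" "m \<noteq> flip l" "m \<noteq> flip (hd w\<^sub>0)"
    by blast
  let ?E = "extensions S l (Suc (length w\<^sub>0))"
  have "m # w\<^sub>0 \<in> ?E"
    using m assms(3-5) by (auto simp: extensions_def reduced_Cons)
  moreover have "\<not> avoids w\<^sub>0 (m # w\<^sub>0)"
    unfolding avoids_def by (metis append_Cons append_Nil append_Nil2)
  ultimately have "{w \<in> ?E. avoids w\<^sub>0 w} \<subseteq> ?E - {m # w\<^sub>0}"
    by auto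
  then have "card {w \<in> ?E. avoids w\<^sub>0 w} \<le> card (?E - {m # w\<^sub>0})"
    by (intro card_mono) (auto simp: finite_extensions assms)
  also have "\<dots> = card ?E - 1"
    using \<open>m # w\<^sub>0 \<in> ?E\<close> by simp
  finally show ?thesis
    by (simp add: card_extensions assms)
qed

text \<open>A word avoiding \<open>w\<^sub>0\<close> splits into a prefix and an extension of its
  last letter, both avoiding \<open>w\<^sub>0\<close>; so every further block loses at least one of
  its \<open>q ^ Suc (length w\<^sub>0)\<close> continuations. The prefix must be nonempty to have a
  last letter.\<close>

lemma card_avoiding_sphere_add:
  assumes "finite S" "card S \<ge> 2" "w\<^sub>0 \<in> reduced_words S" "w\<^sub>0 \<noteq> []" "n > 0"
  shows "card {w \<in> sphere S (n + Suc (length w\<^sub>0)). avoids w\<^sub>0 w}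
           \<le> card {w \<in> sphere S n. avoids w\<^sub>0 w} * ((2 * card S - 1) ^ Suc (length w\<^sub>0) - 1)"
proof -
  define M where "M = Suc (length w\<^sub>0)"
  define P where "P = {w \<in> sphere S n. avoids w\<^sub>0 w}"
  define E where "E = (\<lambda>p. {w \<in> extensions S (last p) M. avoids w\<^sub>0 w})"
  have fin: "finite P" "finite (E p)" for p
    using assms by (auto simp: P_def E_def finite_sphere finite_extensions)
  have "(take n w, drop n w) \<in> Sigma P E" if w: "w \<in> sphere S (n + M)" "avoids w\<^sub>0 w" for w
  proof -
    obtain v e where ve: "w = v @ e" "length v = n" "length e = M"
      using w(1) by (auto simp: sphere_def length_append intro: that[of "take n w" "drop n w"])
    then have "v \<noteq> []" "v @ e \<in> reduced_words S"
      using w(1) assms(5) by (auto simp: sphere_def)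
    moreover from this have "last v \<in> S \<times> UNIV"
      using last_in_set[of v] by (auto simp: reduced_append dest!: reduced_in_lists simp del: mem_Sigma_iff)
    ultimately have "v \<in> sphere S n" "e \<in> extensions S (last v) M"
      using ve by (simp_all add: sphere_def extensions_def reduced_Cons reduced_append)
    moreover have "avoids w\<^sub>0 v" "avoids w\<^sub>0 e"
      using avoids_appendD w(2) ve(1) by blast+
    ultimately show ?thesis
      using ve by (simp add: P_def E_def)
  qed
  then have "(\<lambda>w. (take n w, drop n w)) ` {w \<in> sphere S (n + M). avoids w\<^sub>0 w} \<subseteq> Sigma P E"
    by blast
  moreover have "inj_on (\<lambda>w. (take n w, drop n w)) {w \<in> sphere S (n + M). avoids w\<^sub>0 w}"
    by (rule inj_onI) (metis append_take_drop_id prod.inject)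
  ultimately have "card {w \<in> sphere S (n + M). avoids w\<^sub>0 w} \<le> card (Sigma P E)"
    by (intro card_inj_on_le[where f = "\<lambda>w. (take n w, drop n w)"] finite_SigmaI fin)
  also have "\<dots> = (\<Sum>p\<in>P. card (E p))"
    by (simp add: fin)
  also have "\<dots> \<le> (\<Sum>p\<in>P. (2 * card S - 1) ^ M - 1)"
  proof (rule sum_mono)
    fix p assume "p \<in> P"
    then have "last p \<in> S \<times> UNIV"
      using assms(5) by (cases p rule: rev_cases) (auto simp: P_def sphere_def reduced_words_iff)
    then show "card (E p) \<le> (2 * card S - 1) ^ M - 1"
      unfolding E_def M_def using assms by (intro card_avoiding_extensions)
  qed
  finally show ?thesis
    by (simp add: P_def M_def)
qed

text \<open>Iterating the block estimate multiplies the count by at most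
  \<open>Q = q ^ M - 1\<close> per \<open>M\<close> letters. Losing a single word per block already
  pushes the rate \<open>ln Q / M\<close> strictly below \<open>ln q\<close>.\<close>

lemma card_avoiding_sphere_le:
  assumes "finite S" "card S \<ge> 2" "w\<^sub>0 \<in> reduced_words S" "w\<^sub>0 \<noteq> []"
  shows "\<exists>K \<ge> 1. \<exists>a \<ge> 0. a < ln (real (2 * card S - 1)) \<and>
           (\<forall>n. real (card {w \<in> sphere S n. avoids w\<^sub>0 w}) \<le> K * exp (a * real n))"
proof -
  define q where "q = 2 * card S - 1"
  define M where "M = Suc (length w\<^sub>0)"
  define Q where "Q = q ^ M - 1"
  define a where "a = ln (real Q) / real M"
  define A where "A = (\<lambda>n. card {w \<in> sphere S n. avoids w\<^sub>0 w})"
  have "q \<ge> 3"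
    using assms(2) by (simp add: q_def)
  have "q ^ 1 \<le> q ^ M"
    using \<open>q \<ge> 3\<close> by (intro power_increasing) (auto simp: M_def)
  then have "Q \<ge> 1" "Q < q ^ M"
    using \<open>q \<ge> 3\<close> by (auto simp: Q_def)
  have "a \<ge> 0"
    using \<open>Q \<ge> 1\<close> by (simp add: a_def)
  have "ln (real Q) < ln (real (q ^ M))"
    using \<open>Q \<ge> 1\<close> \<open>Q < q ^ M\<close> \<open>q \<ge> 3\<close>
    by (subst ln_less_cancel_iff) (auto simp del: of_nat_power)
  also have "\<dots> = real M * ln (real q)"
    using \<open>q \<ge> 3\<close> by (simp add: ln_realpow)
  finally have "a < ln (real q)"
    by (simp add: a_def M_def field_simps)
  have exp_a: "exp (a * real (n + M)) = exp (a * real n) * real Q" for n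
  proof -
    have "a * real M = ln (real Q)"
      by (simp add: a_def M_def)
    then show ?thesis
      using \<open>Q \<ge> 1\<close> by (simp add: distrib_left exp_add)
  qed
  \<comment> \<open>This bounds every sphere of radius at most \<open>M\<close>, the initial cases
    of an induction that goes down by \<open>M\<close> letters at a time.\<close>
  define K where "K = 2 * real q ^ M"
  have "real (A n) \<le> K * exp (a * real n)" for n
  proof (induction n rule: less_induct)
    case (less n)
    show ?case
    proof (cases "n \<le> M")
      case True
      have "A n \<le> card (sphere S n)"
        unfolding A_def by (intro card_mono) (auto simp: finite_sphere assms)
      also have "\<dots> \<le> 2 * q ^ n"
        unfolding q_def using assms by (intro card_sphere_le) auto
      also have "\<dots> \<le> 2 * q ^ M"
        using True \<open>q \<ge> 3\<close> by (intro mult_left_mono power_increasing) auto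
      finally have "real (A n) \<le> K"
        unfolding K_def by (metis of_nat_le_iff of_nat_mult of_nat_numeral of_nat_power)
      also have "\<dots> \<le> K * exp (a * real n)"
        using \<open>a \<ge> 0\<close> by (simp add: K_def mult_le_cancel_left1)
      finally show ?thesis .
    next
      case False
      define k where "k = n - M"
      have k: "k > 0" "k < n" "n = k + M"
        using False by (auto simp: k_def M_def)
      have "A n \<le> A k * Q"
        using card_avoiding_sphere_add[OF assms k(1)] by (simp add: A_def k(3) Q_def q_def M_def)
      then have "real (A n) \<le> real (A k) * real Q"
        by (metis of_nat_le_iff of_nat_mult)
      also have "\<dots> \<le> K * exp (a * real k) * real Q"
        using less.IH[OF k(2)] by (rule mult_right_mono) simp
      also have "\<dots> = K * exp (a * real n)"
        using exp_a by (simp add: k(3))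
      finally show ?thesis .
    qed
  qed
  moreover have "K \<ge> 1"
  proof -
    have "1 \<le> real q ^ M"
      using \<open>q \<ge> 3\<close> by (intro one_le_power) simp
    then show ?thesis
      by (simp add: K_def)
  qed
  ultimately show ?thesis
    using \<open>a \<ge> 0\<close> \<open>a < ln (real q)\<close> unfolding A_def q_def by blast
qed

section \<open>Word length in a free group\<close>

locale nonabelian_free_group = group F for F :: "('a, 'm) monoid_scheme" (structure) +
  fixes S :: "'a set"
  assumes free_basis: "free_basis F S"
    and finite_basis: "finite S"
    and not_comm_group: "\<not> comm_group F"
begin

definition reduced_word :: "'a \<Rightarrow> ('a \<times> bool) list" where
  "reduced_word g = inv_into (reduced_words S) (word_value F) g"

definition len :: "'a \<Rightarrow> nat" where
  "len g = length (reduced_word g)"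

lemma basis_closed: "s \<in> S \<Longrightarrow> s \<in> carrier F"
  using free_basis by (auto simp: free_basis_def)

lemma bij_word_value: "bij_betw (word_value F) (reduced_words S) (carrier F)"
  using free_basis by (simp add: free_basis_def)

lemma letter_value_closed: "l \<in> S \<times> UNIV \<Longrightarrow> letter_value F l \<in> carrier F"
  by (auto simp: letter_value_def basis_closed)

lemma letter_value_flip:
  "l \<in> S \<times> UNIV \<Longrightarrow> letter_value F (flip l) = inv (letter_value F l)"
  by (auto simp: letter_value_def flip_def basis_closed)

lemma word_value_Nil [simp]: "word_value F [] = \<one>"
  by (simp add: word_value_def)

lemma word_value_Cons [simp]: "word_value F (l # w) = letter_value F l \<otimes> word_value F w"
  by (simp add: word_value_def)

lemma word_value_closed: "w \<in> lists (S \<times> UNIV) \<Longrightarrow> word_value F w \<in> carrier F"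
  by (induction w) (auto simp: letter_value_closed)

lemma word_value_append:
  "v \<in> lists (S \<times> UNIV) \<Longrightarrow> w \<in> lists (S \<times> UNIV) \<Longrightarrow>
     word_value F (v @ w) = word_value F v \<otimes> word_value F w"
  by (induction v) (auto simp: letter_value_closed word_value_closed m_assoc)

lemma reduced_word_reduced: "g \<in> carrier F \<Longrightarrow> reduced_word g \<in> reduced_words S"
  unfolding reduced_word_def by (metis bij_betw_imp_surj_on bij_word_value inv_into_into)

lemma word_value_reduced_word [simp]: "g \<in> carrier F \<Longrightarrow> word_value F (reduced_word g) = g"
  unfolding reduced_word_def by (metis bij_betw_inv_into_right bij_word_value)

lemma reduced_word_word_value [simp]:
  "w \<in> reduced_words S \<Longrightarrow> reduced_word (word_value F w) = w"
  unfolding reduced_word_def by (metis bij_betw_inv_into_left bij_word_value)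

lemma reduced_word_in_lists: "g \<in> carrier F \<Longrightarrow> reduced_word g \<in> lists (S \<times> UNIV)"
  using reduced_in_lists reduced_word_reduced by blast

lemma len_one [simp]: "len \<one> = 0"
  using reduced_word_word_value[OF Nil_reduced] by (simp add: len_def)

lemma len_letter_mult:
  assumes "l \<in> S \<times> UNIV" "g \<in> carrier F"
  shows "len (letter_value F l \<otimes> g) \<le> Suc (len g)"
proof (cases "l # reduced_word g \<in> reduced_words S")
  case True
  from reduced_word_word_value[OF this] show ?thesis
    using assms by (simp add: len_def)
next
  case False
  then obtain w where w: "reduced_word g = flip l # w"
    using assms reduced_word_reduced[of g] by (cases "reduced_word g") (auto simp: reduced_Cons)
  then have red: "w \<in> reduced_words S"
    using assms reduced_word_reduced[of g] by (simp add: reduced_Cons)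
  have "g = inv (letter_value F l) \<otimes> word_value F w"
    using assms word_value_reduced_word[of g] by (simp add: w letter_value_flip)
  then have "letter_value F l \<otimes> g = word_value F w"
    using assms red by (simp add: m_assoc[symmetric] letter_value_closed word_value_closed reduced_in_lists)
  then show ?thesis
    using red by (simp add: len_def w)
qed

text \<open>Deleting a subword of a reduced word may leave a word that is not reduced; its length
  still bounds \<open>len\<close> of the value.\<close>

lemma len_word_value_le: "w \<in> lists (S \<times> UNIV) \<Longrightarrow> len (word_value F w) \<le> length w"
proof (induction w)
  case (Cons l w)
  then have "len (word_value F (l # w)) \<le> Suc (len (word_value F w))"
    by (auto intro!: len_letter_mult word_value_closed)
  with Cons show ?case by simp
qed simp

lemma len_mult_letter:
  assumes "g \<in> carrier F" "l \<in> S \<times> UNIV"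
  shows "len (g \<otimes> letter_value F l) \<le> Suc (len g)"
proof -
  have "reduced_word g \<in> lists (S \<times> UNIV)" "[l] \<in> lists (S \<times> UNIV)"
    using assms reduced_word_in_lists by auto
  then have "len (word_value F (reduced_word g) \<otimes> word_value F [l]) \<le> length (reduced_word g @ [l])"
    by (metis append_in_lists_conv len_word_value_le word_value_append)
  then show ?thesis
    using assms by (simp add: len_def letter_value_closed)
qed

text \<open>Edges of the Cayley graph join \<open>g\<close> to \<open>g s\<close>, so this makes
  \<open>len\<close> 1-Lipschitz along edges. One of the two inequalities comes from multiplying
  back by \<open>inv s\<close>.\<close>

lemma len_mult_basis:
  assumes "g \<in> carrier F" "s \<in> S"
  shows "\<bar>real (len (g \<otimes> s)) - real (len g)\<bar> \<le> 1"
proof -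
  have "len (g \<otimes> s) \<le> Suc (len g)"
    using len_mult_letter[OF assms(1), of "(s, True)"] assms(2) by (simp add: letter_value_def)
  moreover have "len g \<le> Suc (len (g \<otimes> s))"
    using len_mult_letter[of "g \<otimes> s" "(s, False)"] assms
    by (simp add: letter_value_def basis_closed m_assoc)
  ultimately show ?thesis by linarith
qed

text \<open>A basis element commutes with its inverse, so with fewer than two basis elements all
  words would commute. Non-commutativity enters only here.\<close>

lemma card_basis_ge: "card S \<ge> 2"
proof (rule ccontr)
  assume "\<not> card S \<ge> 2"
  then have "card S \<le> Suc 0" by simp
  then have eq: "s = t" if "s \<in> S" "t \<in> S" for s t
    using that by (metis card_le_Suc0_iff_eq finite_basis)
  have letters: "letter_value F l \<otimes> letter_value F m = letter_value F m \<otimes> letter_value F l"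
    if lm: "l \<in> S \<times> UNIV" "m \<in> S \<times> UNIV" for l m
  proof -
    obtain s b c where "l = (s, b)" "m = (s, c)" "s \<in> S"
      using lm eq by (cases l; cases m) auto
    then show ?thesis
      by (cases b; cases c) (simp_all add: letter_value_def basis_closed)
  qed
  \<comment> \<open>Applied twice: with a letter as \<open>x\<close>, to pass from letters to
    elements on one side, and then with an arbitrary \<open>x\<close>.\<close>
  have commute: "x \<otimes> word_value F w = word_value F w \<otimes> x"
    if "x \<in> carrier F" "\<And>l. l \<in> S \<times> UNIV \<Longrightarrow> x \<otimes> letter_value F l = letter_value F l \<otimes> x"
      "w \<in> lists (S \<times> UNIV)" for x w
    using that(3)
  proof (induction w)
    case (Cons l w)
    then have "l \<in> S \<times> UNIV" "w \<in> lists (S \<times> UNIV)" by auto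
    then have c: "letter_value F l \<in> carrier F" "word_value F w \<in> carrier F"
      by (auto intro: letter_value_closed word_value_closed)
    have "x \<otimes> word_value F (l # w) = x \<otimes> letter_value F l \<otimes> word_value F w"
      using that(1) c by (simp add: m_assoc)
    also have "\<dots> = letter_value F l \<otimes> (x \<otimes> word_value F w)"
      using that(1) c that(2)[OF \<open>l \<in> S \<times> UNIV\<close>] by (simp add: m_assoc)
    also have "\<dots> = word_value F (l # w) \<otimes> x"
      using that(1) c Cons.IH by (simp add: m_assoc)
    finally show ?case .
  qed (use that(1) in simp)
  have "x \<otimes> y = y \<otimes> x" if xy: "x \<in> carrier F" "y \<in> carrier F" for x y
  proof -
    have "x \<otimes> letter_value F l = letter_value F l \<otimes> x" if "l \<in> S \<times> UNIV" for l
      using commute[of "letter_value F l" "reduced_word x"] letters xy(1) that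
      by (simp add: letter_value_closed reduced_word_in_lists)
    then show ?thesis
      using commute[of x "reduced_word y"] xy by (simp add: reduced_word_in_lists)
  qed
  then have "comm_group F"
    by (intro group_comm_groupI) auto
  with not_comm_group show False ..
qed

section \<open>The growth rate \<open>ln q\<close> and the sizes of spheres in
  \<open>F\<close>\<close>

definition growth :: real where
  "growth = ln (real (2 * card S - 1))"

lemma growth_pos: "growth > 0"
  using card_basis_ge unfolding growth_def by (intro ln_gt_zero) linarith

lemma exp_growth_mult: "exp (growth * real n) = real ((2 * card S - 1) ^ n)"
proof -
  have "growth * real n = real n * growth"
    by (rule mult.commute)
  moreover have "exp growth = real (2 * card S - 1)"
    unfolding growth_def by (rule exp_ln) (use card_basis_ge in simp)
  ultimately show ?thesis
    by (simp only: exp_of_nat_mult of_nat_power)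
qed

lemma bij_sphere: "bij_betw (word_value F) (sphere S n) {g \<in> carrier F. len g = n}"
proof (rule bij_betw_subset[OF bij_word_value, THEN bij_betw_cong[THEN iffD1, rotated]])
  show "sphere S n \<subseteq> reduced_words S"
    by (auto simp: sphere_def)
  show "word_value F ` sphere S n = {g \<in> carrier F. len g = n}"
  proof (intro equalityI subsetI)
    fix g assume "g \<in> {g \<in> carrier F. len g = n}"
    then have "reduced_word g \<in> sphere S n" "g = word_value F (reduced_word g)"
      by (auto simp: sphere_def len_def reduced_word_reduced)
    then show "g \<in> word_value F ` sphere S n" by blast
  qed (auto simp: sphere_def len_def reduced_in_lists word_value_closed)
qed simp

lemma finite_len_eq: "finite {g \<in> carrier F. len g = n}"
  using bij_betw_finite[OF bij_sphere] finite_sphere[OF finite_basis] by simp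

lemma card_len_eq: "card {g \<in> carrier F. len g = n} = card (sphere S n)"
  using bij_betw_same_card[OF bij_sphere] by simp

lemma card_len_eq_le: "real (card {g \<in> carrier F. len g = n}) \<le> 2 * exp (growth * real n)"
proof -
  have "card {g \<in> carrier F. len g = n} \<le> 2 * (2 * card S - 1) ^ n"
    using card_sphere_le[of S n] card_basis_ge by (simp add: card_len_eq finite_basis)
  then show ?thesis
    unfolding exp_growth_mult by (metis of_nat_le_iff of_nat_mult of_nat_numeral)
qed

lemma card_len_eq_ge: "exp (growth * real n) \<le> real (card {g \<in> carrier F. len g = n})"
  unfolding exp_growth_mult card_len_eq of_nat_le_iff by (rule card_sphere_ge[OF finite_basis])

text \<open>All spheres are nonempty, so every natural number is a length. Infinitude lets a factor
  of \<open>F \<times> F\<close> serve as an infinite normal subgroup.\<close>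

lemma infinite_carrier: "infinite (carrier F)"
proof
  assume fin: "finite (carrier F)"
  have "n \<in> len ` carrier F" for n
  proof -
    have "card {g \<in> carrier F. len g = n} \<noteq> 0"
      using card_len_eq_ge[of n] exp_gt_zero[of "growth * real n"] by linarith
    then have "{g \<in> carrier F. len g = n} \<noteq> {}" by force
    then show ?thesis by blast
  qed
  then have "UNIV \<subseteq> len ` carrier F" by blast
  then show False
    using fin finite_surj infinite_UNIV_nat by blast
qed

text \<open>
  A letter that differs from the first letter of \<open>g\<close> and cancels at neither end of \<open>g\<close> does
  not commute with \<open>g\<close>.
\<close>

lemma trivial_center:
  assumes g: "g \<in> carrier F" "g \<noteq> \<one>"
  shows "\<exists>x \<in> carrier F. g \<otimes> x \<noteq> x \<otimes> g"
proof -
  define w where "w = reduced_word g"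
  have w: "w \<in> reduced_words S" "w \<noteq> []" "word_value F w = g"
    using g word_value_reduced_word[of g]
    by (auto simp: w_def reduced_word_reduced simp del: word_value_reduced_word)
  \<comment> \<open>At most three letters are excluded, while two basis elements provide
    four.\<close>
  let ?B = "{hd w, flip (hd w), flip (last w)}"
  have "\<not> S \<times> (UNIV :: bool set) \<subseteq> ?B"
  proof
    assume "S \<times> (UNIV :: bool set) \<subseteq> ?B"
    then have "card (S \<times> (UNIV :: bool set)) \<le> card ?B"
      by (intro card_mono) auto
    also have "\<dots> \<le> 3"
      by (simp add: card_insert_if)
    finally show False
      using card_basis_ge finite_basis by (simp add: card_letters)
  qed
  then obtain l where l: "l \<in> S \<times> UNIV" "l \<noteq> hd w" "l \<noteq> flip (hd w)" "l \<noteq> flip (last w)"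
    by blast
  have "hd w \<noteq> flip l"
    using l(3) by (metis flip_flip)
  then have red: "l # w \<in> reduced_words S" "w @ [l] \<in> reduced_words S"
    using w l by (auto simp: reduced_Cons reduced_append)
  have "l # w \<noteq> w @ [l]"
    using l(2) w(2) by (cases w) auto
  then have "word_value F (l # w) \<noteq> word_value F (w @ [l])"
    using red reduced_word_word_value by metis
  moreover have "word_value F (w @ [l]) = g \<otimes> letter_value F l"
    using w l by (subst word_value_append) (auto simp: reduced_in_lists letter_value_closed)
  ultimately show ?thesis
    using l(1) w(3) by (metis letter_value_closed word_value_Cons)
qed

section \<open>Growth tightness of a free group\<close>

text \<open>An upper bound \<open>a\<close> for the exponent of \<open>F\<close> modulo
  \<open>M\<close>, stated through representatives: \<open>X\<close> meets every coset
  \<open>M g\<close> in an element no longer than \<open>g\<close>, and may contain several elements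
  of a coset. In this form the bounds for the two factors combine by taking products of
  sets.\<close>

definition coset_growth_le :: "'a set \<Rightarrow> real \<Rightarrow> bool" where
  "coset_growth_le M a \<longleftrightarrow>
     (\<exists>X \<subseteq> carrier F. \<exists>K \<ge> 1. (\<forall>n. real (card {x \<in> X. len x = n}) \<le> K * exp (a * real n)) \<and>
        (\<forall>g \<in> carrier F. \<exists>x \<in> X. len x \<le> len g \<and> x \<otimes> inv g \<in> M))"

text \<open>All of \<open>F\<close> serves as \<open>X\<close>. This is the bound for a factor that
  \<open>N\<close> may meet trivially.\<close>

lemma coset_growth_le_growth:
  assumes "\<one> \<in> M"
  shows "coset_growth_le M growth"
  unfolding coset_growth_le_def
proof (intro exI[of _ "carrier F"] exI[of _ 2] conjI ballI allI)
  show "\<exists>x \<in> carrier F. len x \<le> len g \<and> x \<otimes> inv g \<in> M" if "g \<in> carrier F" for g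
    using assms that by (intro bexI[of _ g]) simp_all
qed (use card_len_eq_le in simp_all)

text \<open>
  A shortest representative of a coset of \<open>M\<close> does not contain the reduced word of an element
  of \<open>M\<close>, since deleting it would give a shorter representative.
\<close>

lemma coset_growth_le_less:
  assumes "M \<lhd> F" "M \<noteq> {\<one>}"
  shows "\<exists>a \<ge> 0. a < growth \<and> coset_growth_le M a"
proof -
  interpret M: normal M F by fact
  obtain m where m: "m \<in> M" "m \<noteq> \<one>"
    using assms(2) M.one_closed by blast
  have mF: "m \<in> carrier F"
    using m(1) by (rule M.mem_carrier)
  define w\<^sub>0 where "w\<^sub>0 = reduced_word m"
  have w\<^sub>0: "w\<^sub>0 \<in> reduced_words S" "w\<^sub>0 \<noteq> []" "word_value F w\<^sub>0 = m"
    using m mF word_value_reduced_word[of m]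
    by (auto simp: w\<^sub>0_def reduced_word_reduced simp del: word_value_reduced_word)
  obtain K a where K: "K \<ge> 1" "a \<ge> 0" "a < growth"
    "\<And>n. real (card {w \<in> sphere S n. avoids w\<^sub>0 w}) \<le> K * exp (a * real n)"
    using card_avoiding_sphere_le[OF finite_basis card_basis_ge w\<^sub>0(1,2)]
    unfolding growth_def by blast
  define X where "X = {x \<in> carrier F. avoids w\<^sub>0 (reduced_word x)}"
  have "card {x \<in> X. len x = n} \<le> card {w \<in> sphere S n. avoids w\<^sub>0 w}" for n
  proof (rule card_inj_on_le[where f = reduced_word])
    show "inj_on reduced_word {x \<in> X. len x = n}"
      by (rule inj_onI) (metis (mono_tags, lifting) X_def mem_Collect_eq word_value_reduced_word)
    show "reduced_word ` {x \<in> X. len x = n} \<subseteq> {w \<in> sphere S n. avoids w\<^sub>0 w}"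
      by (auto simp: X_def sphere_def len_def reduced_word_reduced)
  qed (simp add: finite_sphere finite_basis)
  then have card_X: "real (card {x \<in> X. len x = n}) \<le> K * exp (a * real n)" for n
    using K(4)[of n] by (meson of_nat_le_iff order_trans)
  have repr: "\<exists>x \<in> X. len x \<le> len g \<and> x \<otimes> inv g \<in> M" if g: "g \<in> carrier F" for g
  proof -
    let ?P = "\<lambda>x. x \<in> carrier F \<and> x \<otimes> inv g \<in> M"
    define x where "x = (ARG_MIN len x. ?P x)"
    have "?P g" using g by simp
    then have x: "?P x" and min: "\<And>y. ?P y \<Longrightarrow> len x \<le> len y"
      unfolding x_def by (metis (mono_tags, lifting) arg_min_natI, metis (mono_tags, lifting) arg_min_nat_le)
    have "avoids w\<^sub>0 (reduced_word x)"
      unfolding avoids_def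
    proof
      assume "\<exists>p s. reduced_word x = p @ w\<^sub>0 @ s"
      then obtain p s where ps: "reduced_word x = p @ w\<^sub>0 @ s" by blast
      then have lists: "p \<in> lists (S \<times> UNIV)" "s \<in> lists (S \<times> UNIV)" "w\<^sub>0 \<in> lists (S \<times> UNIV)"
        using reduced_word_in_lists[of x] x by simp_all
      define y z where "y = word_value F p" and "z = word_value F s"
      have yz: "y \<in> carrier F" "z \<in> carrier F"
        using lists by (simp_all add: y_def z_def word_value_closed)
      have "x = word_value F (p @ w\<^sub>0 @ s)"
        using x ps by (metis word_value_reduced_word)
      also have "\<dots> = y \<otimes> (m \<otimes> z)"
        using lists w\<^sub>0(3) by (simp only: word_value_append append_in_lists_conv y_def z_def simp_thms)
      finally have xeq: "x = y \<otimes> (m \<otimes> z)" .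
      \<comment> \<open>Passing from \<open>x = y m z\<close> to \<open>y z\<close> multiplies from
        the left by the conjugate \<open>y m^-1 y^-1\<close>, which normality keeps in
        \<open>M\<close>; hence \<open>y z\<close> lies in the same coset.\<close>
      have "inv m \<otimes> (inv y \<otimes> x) = z"
        using yz mF
        by (simp add: xeq m_assoc[of "inv y" y "m \<otimes> z", symmetric] m_assoc[of "inv m" m z, symmetric])
      then have "y \<otimes> z \<otimes> inv g = y \<otimes> (inv m \<otimes> (inv y \<otimes> x)) \<otimes> inv g"
        by simp
      also have "\<dots> = (y \<otimes> inv m \<otimes> inv y) \<otimes> (x \<otimes> inv g)"
        using yz mF g x by (simp add: m_assoc)
      finally have "y \<otimes> z \<otimes> inv g = (y \<otimes> inv m \<otimes> inv y) \<otimes> (x \<otimes> inv g)" .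
      moreover have "y \<otimes> inv m \<otimes> inv y \<in> M"
        using m(1) yz(1) by (intro M.inv_op_closed2) auto
      ultimately have "?P (y \<otimes> z)"
        using x yz by simp
      from min[OF this] have "len x \<le> len (word_value F (p @ s))"
        using lists by (simp add: word_value_append y_def z_def)
      also have "\<dots> \<le> length (p @ s)"
        using lists by (intro len_word_value_le) simp
      finally show False
        using w\<^sub>0(2) ps by (simp add: len_def)
    qed
    then show ?thesis
      using x min[OF \<open>?P g\<close>] by (auto simp: X_def)
  qed
  have "X \<subseteq> carrier F" by (auto simp: X_def)
  then have "coset_growth_le M a"
    unfolding coset_growth_le_def using K(1) card_X repr by blast
  with K(2,3) show ?thesis by blast
qed

end

section \<open>Bounds for growth exponents\<close>

text \<open>Logarithm and division by \<open>r\<close> remove the constant, the quadratic factor and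
  the shift of the radius. The quadratic factor leaves room for the number of pairs of lengths, the
  shift for cosets whose distance is only nearly attained.\<close>

lemma growth_exponent_le:
  assumes "\<And>r. r \<ge> 0 \<Longrightarrow> finite {a \<in> A. d a\<^sub>0 a \<le> r} \<and>
             real (card {a \<in> A. d a\<^sub>0 a \<le> r}) \<le> K * (r + 2)\<^sup>2 * exp (c * (r + 1))"
    and "K \<ge> 1" "c \<ge> 0"
  shows "growth_exponent A d a\<^sub>0 \<le> ereal c"
proof -
  have "log_count {a \<in> A. d a\<^sub>0 a \<le> r} / ereal r
          \<le> ereal ((ln K + 2 * ln (r + 2) + c * (r + 1)) / r)" if r: "r > 0" for r
  proof -
    let ?B = "{a \<in> A. d a\<^sub>0 a \<le> r}" and ?b = "K * (r + 2)\<^sup>2 * exp (c * (r + 1))"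
    have fin: "finite ?B" "real (card ?B) \<le> ?b"
      using assms(1)[of r] r by auto
    \<comment> \<open>The logarithm of the bound is thus nonnegative and also dominates
      \<open>ln 0 = 0\<close>, the value for an empty ball.\<close>
    have "1 * 1 * 1 \<le> ?b"
      using assms(2,3) r by (intro mult_mono) (auto intro: one_le_power)
    then have "ln (real (card ?B)) \<le> ln ?b"
      using fin(2) by (cases "card ?B = 0") auto
    also have "\<dots> = ln K + 2 * ln (r + 2) + c * (r + 1)"
      using assms(2) r by (simp add: ln_mult ln_realpow)
    finally show ?thesis
      using r fin(1) by (simp add: log_count_def divide_right_mono)
  qed
  then have "growth_exponent A d a\<^sub>0
      \<le> Limsup at_top (\<lambda>r. ereal ((ln K + 2 * ln (r + 2) + c * (r + 1)) / r))"
    unfolding growth_exponent_def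
    by (intro Limsup_mono eventually_mono[OF eventually_gt_at_top[of 0]])
  also have "\<dots> = ereal c"
  proof (rule lim_imp_Limsup)
    have "((\<lambda>r. (ln K + 2 * ln (r + 2) + c * (r + 1)) / r) \<longlongrightarrow> c) at_top"
      by real_asymp
    then show "((\<lambda>r. ereal ((ln K + 2 * ln (r + 2) + c * (r + 1)) / r)) \<longlongrightarrow> ereal c) at_top"
      by simp
  qed simp
  finally show ?thesis .
qed

text \<open>A finite subset of each ball suffices, since an infinite ball has infinite
  \<open>log_count\<close>. The constant \<open>C\<close> allows for rounding the radius.\<close>

lemma growth_exponent_ge:
  assumes "\<And>r. r \<ge> 0 \<Longrightarrow>
             \<exists>X \<subseteq> {a \<in> A. d a\<^sub>0 a \<le> r}. finite X \<and> exp (c * r - C) \<le> real (card X)"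
  shows "ereal c \<le> growth_exponent A d a\<^sub>0"
proof -
  have "ereal ((c * r - C) / r) \<le> log_count {a \<in> A. d a\<^sub>0 a \<le> r} / ereal r" if r: "r > 0" for r
  proof (cases "finite {a \<in> A. d a\<^sub>0 a \<le> r}")
    case True
    obtain X where X: "X \<subseteq> {a \<in> A. d a\<^sub>0 a \<le> r}" "exp (c * r - C) \<le> real (card X)"
      using assms[of r] r by auto
    have "exp (c * r - C) \<le> real (card {a \<in> A. d a\<^sub>0 a \<le> r})"
      using X(2) card_mono[OF True X(1)] by linarith
    moreover from this have "0 < real (card {a \<in> A. d a\<^sub>0 a \<le> r})"
      using exp_gt_zero[of "c * r - C"] by linarith
    ultimately have "c * r - C \<le> ln (real (card {a \<in> A. d a\<^sub>0 a \<le> r}))"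
      by (simp add: ln_ge_iff)
    with True r show ?thesis
      by (simp add: log_count_def divide_right_mono)
  qed (use r in \<open>simp add: log_count_def\<close>)
  then have "Limsup at_top (\<lambda>r. ereal ((c * r - C) / r)) \<le> growth_exponent A d a\<^sub>0"
    unfolding growth_exponent_def
    by (intro Limsup_mono eventually_mono[OF eventually_gt_at_top[of 0]])
  moreover have "Limsup at_top (\<lambda>r. ereal ((c * r - C) / r)) = ereal c"
  proof (rule lim_imp_Limsup)
    have "((\<lambda>r. (c * r - C) / r) \<longlongrightarrow> c) at_top"
      by real_asymp
    then show "((\<lambda>r. ereal ((c * r - C) / r)) \<longlongrightarrow> ereal c) at_top"
      by simp
  qed simp
  ultimately show ?thesis by simp
qed

section \<open>Length metrics\<close>

lemma string_length_trans:
  "string_length R x y l \<Longrightarrow> string_length R y z m \<Longrightarrow> string_length R x z (l + m)"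
proof (induction rule: string_length.induct)
  case (step x y l z' m')
  then show ?case
    using string_length.step[of R x y l z "m' + m"] by (simp add: add.assoc)
qed simp

lemma string_length_mono:
  assumes "string_length R x y l" "\<And>x y l. R x y l \<Longrightarrow> R' x y l"
  shows "string_length R' x y l"
  using assms(1) by induction (auto intro: string_length.intros assms(2))

lemma string_length_ge:
  assumes "string_length R x y l" "\<And>x y l. R x y l \<Longrightarrow> D x y \<le> l"
    and "\<And>x. D x x = 0" "\<And>x y z. D x z \<le> D x y + D y z"
  shows "D x y \<le> (l :: real)"
  using assms(1)
proof induction
  case (step x y l z m)
  then show ?case
    using assms(2)[of x y l] assms(4)[of x z y] by linarith
qed (simp add: assms(3))

text \<open>\<open>D\<close> acts as a calibration: its triangle inequality turns a bound on single
  cells into a bound on all strings. A string must exist because \<open>Inf\<close> of the empty set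
  says nothing.\<close>

lemma length_metric_ge:
  assumes "\<And>x y l. R x y l \<Longrightarrow> D x y \<le> l"
    and "\<And>x. D x x = 0" "\<And>x y z. D x z \<le> D x y + D y z"
    and "\<exists>l. string_length R x y l"
  shows "D x y \<le> length_metric R x y"
  unfolding length_metric_def
  using assms by (intro cInf_greatest) (auto intro: string_length_ge[of R x y _ D])

lemma length_metric_le:
  assumes "string_length R x y l" "\<And>x y l. R x y l \<Longrightarrow> l \<ge> 0"
  shows "length_metric R x y \<le> l"
  unfolding length_metric_def
proof (rule cInf_lower)
  have "0 \<le> l'" if "string_length R x y l'" for l'
    using that by induction (auto dest: assms(2))
  then show "bdd_below {l. string_length R x y l}"
    by (auto intro!: bdd_belowI[of _ 0])
qed (use assms(1) in simp)

section \<open>The two metrics on the vertices\<close>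

context nonabelian_free_group
begin

text \<open>The distance from the vertex \<open>inv k\<close>, extended to the edges by linear interpolation.\<close>

primrec tree_height :: "'a \<Rightarrow> 'a tree_point \<Rightarrow> real" where
  "tree_height k (Vertex g) = real (len (k \<otimes> g))"
| "tree_height k (Interior g s t) =
     (1 - t) * real (len (k \<otimes> g)) + t * real (len (k \<otimes> (g \<otimes> s)))"

lemma tree_height_edge_point:
  "tree_height k (edge_point F g s t) =
     (1 - t) * real (len (k \<otimes> g)) + t * real (len (k \<otimes> (g \<otimes> s)))"
  by (simp add: edge_point_def)

lemma tree_height_edge_lipschitz:
  assumes "k \<in> carrier F" "g \<in> carrier F" "s \<in> S"
  shows "\<bar>tree_height k (edge_point F g s a) - tree_height k (edge_point F g s b)\<bar> \<le> \<bar>a - b\<bar>"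
proof -
  have "tree_height k (edge_point F g s a) - tree_height k (edge_point F g s b) =
        (a - b) * (real (len (k \<otimes> g \<otimes> s)) - real (len (k \<otimes> g)))"
    using assms by (simp add: tree_height_edge_point m_assoc basis_closed algebra_simps)
  also have "\<bar>\<dots>\<bar> \<le> \<bar>a - b\<bar> * 1"
    unfolding abs_mult using assms by (intro mult_left_mono len_mult_basis) auto
  finally show ?thesis by simp
qed

text \<open>Edges are oriented by \<open>S\<close>: a positive letter follows the edge that starts
  at \<open>g\<close>, a negative one runs backwards along the edge that starts at
  \<open>g s^-1\<close>.\<close>

lemma letter_edge:
  assumes "g \<in> carrier F" "l \<in> S \<times> UNIV"
  shows "\<exists>e \<in> carrier F. \<exists>s \<in> S. \<exists>a \<in> {0..1}. \<exists>b \<in> {0..1}. \<bar>a - b\<bar> = 1 \<and>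
           Vertex g = edge_point F e s a \<and> Vertex (g \<otimes> letter_value F l) = edge_point F e s b"
proof -
  obtain s c where l: "l = (s, c)" "s \<in> S"
    using assms(2) by (cases l) auto
  show ?thesis
  proof (cases c)
    case True
    show ?thesis
      by (rule bexI[of _ g], rule bexI[of _ s], rule bexI[of _ 0], rule bexI[of _ 1])
        (use True l assms in \<open>auto simp: edge_point_def letter_value_def\<close>)
  next
    case False
    show ?thesis
      by (rule bexI[of _ "g \<otimes> inv s"], rule bexI[of _ s], rule bexI[of _ 1], rule bexI[of _ 0])
        (use False l assms in \<open>auto simp: edge_point_def letter_value_def m_assoc basis_closed\<close>)
  qed
qed

lemma edge_string_fst:
  assumes "w \<in> lists (S \<times> UNIV)" "g \<in> carrier F" "h \<in> carrier F"
  shows "string_length (edge_dist F S) (Vertex g, Vertex h)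
           (Vertex (g \<otimes> word_value F w), Vertex h) (real (length w))"
  using assms
proof (induction w arbitrary: g)
  case (Cons l w)
  then have lw: "l \<in> S \<times> UNIV" "w \<in> lists (S \<times> UNIV)" by auto
  have "edge_dist F S (Vertex g, Vertex h) (Vertex (g \<otimes> letter_value F l), Vertex h) 1"
    using letter_edge[OF Cons.prems(1) lw(1)] Cons.prems(2) unfolding edge_dist_def by metis
  moreover have "string_length (edge_dist F S) (Vertex (g \<otimes> letter_value F l), Vertex h)
      (Vertex (g \<otimes> letter_value F l \<otimes> word_value F w), Vertex h) (real (length w))"
    using Cons.IH[of "g \<otimes> letter_value F l"] Cons.prems lw by (simp add: letter_value_closed)
  ultimately have "string_length (edge_dist F S) (Vertex g, Vertex h)
      (Vertex (g \<otimes> letter_value F l \<otimes> word_value F w), Vertex h) (1 + real (length w))"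
    by (rule string_length.step)
  then show ?case
    using Cons.prems lw by (simp add: m_assoc letter_value_closed word_value_closed)
qed (simp add: string_length.refl)

lemma edge_string_snd:
  assumes "w \<in> lists (S \<times> UNIV)" "g \<in> carrier F" "h \<in> carrier F"
  shows "string_length (edge_dist F S) (Vertex h, Vertex g)
           (Vertex h, Vertex (g \<otimes> word_value F w)) (real (length w))"
  using assms
proof (induction w arbitrary: g)
  case (Cons l w)
  then have lw: "l \<in> S \<times> UNIV" "w \<in> lists (S \<times> UNIV)" by auto
  have "edge_dist F S (Vertex h, Vertex g) (Vertex h, Vertex (g \<otimes> letter_value F l)) 1"
    using letter_edge[OF Cons.prems(1) lw(1)] Cons.prems(2) unfolding edge_dist_def by metis
  moreover have "string_length (edge_dist F S) (Vertex h, Vertex (g \<otimes> letter_value F l))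
      (Vertex h, Vertex (g \<otimes> letter_value F l \<otimes> word_value F w)) (real (length w))"
    using Cons.IH[of "g \<otimes> letter_value F l"] Cons.prems lw by (simp add: letter_value_closed)
  ultimately have "string_length (edge_dist F S) (Vertex h, Vertex g)
      (Vertex h, Vertex (g \<otimes> letter_value F l \<otimes> word_value F w)) (1 + real (length w))"
    by (rule string_length.step)
  then show ?case
    using Cons.prems lw by (simp add: m_assoc letter_value_closed word_value_closed)
qed (simp add: string_length.refl)

lemma edge_string:
  assumes "g \<in> carrier F" "h \<in> carrier F" "x \<in> carrier F" "y \<in> carrier F"
  shows "string_length (edge_dist F S) (Vertex g, Vertex h)
           (Vertex (g \<otimes> x), Vertex (h \<otimes> y)) (real (len x + len y))"
proof -
  have "string_length (edge_dist F S) (Vertex g, Vertex h) (Vertex (g \<otimes> x), Vertex h) (real (len x))"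
    using edge_string_fst[of "reduced_word x" g h] assms by (simp add: reduced_word_in_lists len_def)
  moreover have "string_length (edge_dist F S) (Vertex (g \<otimes> x), Vertex h)
      (Vertex (g \<otimes> x), Vertex (h \<otimes> y)) (real (len y))"
    using edge_string_snd[of "reduced_word y" h "g \<otimes> x"] assms
    by (simp add: reduced_word_in_lists len_def)
  ultimately show ?thesis
    using string_length_trans by fastforce
qed

text \<open>The fixed vertex is the start of an edge in its factor, for which the label
  \<open>s\<close> of the given edge serves again; so the edge is a side of a square and keeps its
  length there. This transfers the existence of strings from edges to squares.\<close>

lemma edge_dist_imp_square_dist:
  assumes "edge_dist F S x y l"
  shows "square_dist F S x y l"
proof -
  obtain g h s a b where *: "g \<in> carrier F" "h \<in> carrier F" "s \<in> S" "a \<in> {0..1}" "b \<in> {0..1}"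
    "l = \<bar>a - b\<bar>"
    "x = (edge_point F g s a, Vertex h) \<and> y = (edge_point F g s b, Vertex h) \<or>
     x = (Vertex h, edge_point F g s a) \<and> y = (Vertex h, edge_point F g s b)"
    using assms unfolding edge_dist_def by blast
  have v: "Vertex h = edge_point F h s 0"
    by (simp add: edge_point_def)
  have l: "l = sqrt ((a - b)\<^sup>2 + (0 - 0)\<^sup>2)" "l = sqrt ((0 - 0)\<^sup>2 + (a - b)\<^sup>2)"
    using *(6) by simp_all
  have 0: "(0 :: real) \<in> {0..1}" by simp
  from *(7) show ?thesis
    unfolding square_dist_def v using *(1-5) l 0 by metis
qed

text \<open>Reading two words of the same length in parallel crosses one square diagonally per pair
  of letters.\<close>

lemma square_string_diagonal:
  assumes "length w = length w'" "w \<in> lists (S \<times> UNIV)" "w' \<in> lists (S \<times> UNIV)"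
    "g \<in> carrier F" "h \<in> carrier F"
  shows "string_length (square_dist F S) (Vertex g, Vertex h)
           (Vertex (g \<otimes> word_value F w), Vertex (h \<otimes> word_value F w')) (sqrt 2 * real (length w))"
  using assms
proof (induction w w' arbitrary: g h rule: list_induct2)
  case (Cons l w l' w')
  then have lw: "l \<in> S \<times> UNIV" "w \<in> lists (S \<times> UNIV)" "l' \<in> S \<times> UNIV" "w' \<in> lists (S \<times> UNIV)"
    by auto
  have "sqrt ((a - b)\<^sup>2 + (a' - b')\<^sup>2) = sqrt 2" if "\<bar>a - b\<bar> = 1" "\<bar>a' - b'\<bar> = 1" for a b a' b' :: real
    using that by (metis one_add_one one_power2 power2_abs)
  then have "square_dist F S (Vertex g, Vertex h)
      (Vertex (g \<otimes> letter_value F l), Vertex (h \<otimes> letter_value F l')) (sqrt 2)"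
    using letter_edge[OF Cons.prems(3) lw(1)] letter_edge[OF Cons.prems(4) lw(3)]
    unfolding square_dist_def by metis
  moreover have "string_length (square_dist F S)
      (Vertex (g \<otimes> letter_value F l), Vertex (h \<otimes> letter_value F l'))
      (Vertex (g \<otimes> letter_value F l \<otimes> word_value F w), Vertex (h \<otimes> letter_value F l' \<otimes> word_value F w'))
      (sqrt 2 * real (length w))"
    using Cons.IH[of "g \<otimes> letter_value F l" "h \<otimes> letter_value F l'"] Cons.prems lw
    by (simp add: letter_value_closed)
  ultimately have "string_length (square_dist F S) (Vertex g, Vertex h)
      (Vertex (g \<otimes> letter_value F l \<otimes> word_value F w), Vertex (h \<otimes> letter_value F l' \<otimes> word_value F w'))
      (sqrt 2 + sqrt 2 * real (length w))"
    by (rule string_length.step)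
  then show ?case
    using Cons.prems lw by (simp add: m_assoc letter_value_closed word_value_closed algebra_simps)
qed (simp add: string_length.refl)

section \<open>Upper and lower estimates of the two metrics by word lengths\<close>

lemma one_skeleton_metric_le:
  assumes "g \<in> carrier F" "h \<in> carrier F" "x \<in> carrier F" "y \<in> carrier F"
  shows "one_skeleton_metric F S (Vertex g, Vertex h) (Vertex (g \<otimes> x), Vertex (h \<otimes> y))
           \<le> real (len x + len y)"
  unfolding one_skeleton_metric_def
  by (rule length_metric_le[OF edge_string[OF assms]]) (auto simp: edge_dist_def)

lemma piecewise_euclidean_metric_le:
  assumes "g \<in> carrier F" "h \<in> carrier F" "x \<in> carrier F" "y \<in> carrier F" "len x = len y"
  shows "piecewise_euclidean_metric F S (Vertex g, Vertex h) (Vertex (g \<otimes> x), Vertex (h \<otimes> y))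
           \<le> sqrt 2 * real (len x)"
  unfolding piecewise_euclidean_metric_def
proof (rule length_metric_le)
  show "string_length (square_dist F S) (Vertex g, Vertex h)
      (Vertex (g \<otimes> x), Vertex (h \<otimes> y)) (sqrt 2 * real (len x))"
    using square_string_diagonal[of "reduced_word x" "reduced_word y" g h] assms
    by (simp add: reduced_word_in_lists len_def)
qed (auto simp: square_dist_def)

lemma edge_string_exists:
  assumes "g \<in> carrier F" "h \<in> carrier F" "x \<in> carrier F" "y \<in> carrier F"
  shows "\<exists>l. string_length (edge_dist F S) (Vertex g, Vertex h) (Vertex x, Vertex y) l"
  using edge_string[of g h "inv g \<otimes> x" "inv h \<otimes> y"] assms
  by (auto simp: m_assoc[symmetric])

text \<open>The comparison function adds the changes of the heights measured from \<open>g\<close>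
  and from \<open>h\<close>. Both heights vanish at the first vertex, and an edge of the product
  changes only one coordinate.\<close>

lemma one_skeleton_metric_ge:
  assumes "g \<in> carrier F" "h \<in> carrier F" "x \<in> carrier F" "y \<in> carrier F"
  shows "real (len (inv g \<otimes> x)) + real (len (inv h \<otimes> y))
           \<le> one_skeleton_metric F S (Vertex g, Vertex h) (Vertex x, Vertex y)"
proof -
  define D where "D = (\<lambda>p q. \<bar>tree_height (inv g) (fst p) - tree_height (inv g) (fst q)\<bar> +
                              \<bar>tree_height (inv h) (snd p) - tree_height (inv h) (snd q)\<bar>)"
  have "D p q \<le> l" if "edge_dist F S p q l" for p q l
    using that tree_height_edge_lipschitz[of "inv g"] tree_height_edge_lipschitz[of "inv h"] assms
    unfolding D_def edge_dist_def by fastforce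
  then have "D (Vertex g, Vertex h) (Vertex x, Vertex y)
      \<le> one_skeleton_metric F S (Vertex g, Vertex h) (Vertex x, Vertex y)"
    unfolding one_skeleton_metric_def
    by (rule length_metric_ge) (auto simp: D_def edge_string_exists assms)
  then show ?thesis
    using assms by (simp add: D_def)
qed

lemma piecewise_euclidean_metric_ge:
  assumes "g \<in> carrier F" "h \<in> carrier F" "x \<in> carrier F" "y \<in> carrier F"
  shows "sqrt ((real (len (inv g \<otimes> x)))\<^sup>2 + (real (len (inv h \<otimes> y)))\<^sup>2)
           \<le> piecewise_euclidean_metric F S (Vertex g, Vertex h) (Vertex x, Vertex y)"
proof -
  define D where "D = (\<lambda>p q. sqrt ((tree_height (inv g) (fst p) - tree_height (inv g) (fst q))\<^sup>2 +
                                   (tree_height (inv h) (snd p) - tree_height (inv h) (snd q))\<^sup>2))"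
  have "D p q \<le> l" if pq: "square_dist F S p q l" for p q l
  proof -
    obtain e e' s s' a a' b b' where *: "e \<in> carrier F" "e' \<in> carrier F" "s \<in> S" "s' \<in> S"
      "p = (edge_point F e s a, edge_point F e' s' a')"
      "q = (edge_point F e s b, edge_point F e' s' b')"
      "l = sqrt ((a - b)\<^sup>2 + (a' - b')\<^sup>2)"
      using pq unfolding square_dist_def by blast
    have "(tree_height (inv g) (fst p) - tree_height (inv g) (fst q))\<^sup>2 \<le> (a - b)\<^sup>2"
      "(tree_height (inv h) (snd p) - tree_height (inv h) (snd q))\<^sup>2 \<le> (a' - b')\<^sup>2"
      using * assms by (auto simp: abs_le_square_iff[symmetric] tree_height_edge_lipschitz)
    then show ?thesis
      unfolding D_def *(7) by (intro real_sqrt_le_mono add_mono)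
  qed
  \<comment> \<open>Minkowski's inequality in the plane, applied to the pairs of height
    differences.\<close>
  moreover have "D p r \<le> D p q + D q r" for p q r
    unfolding D_def
    using real_sqrt_sum_squares_triangle_ineq[of
        "tree_height (inv g) (fst p) - tree_height (inv g) (fst q)"
        "tree_height (inv g) (fst q) - tree_height (inv g) (fst r)"
        "tree_height (inv h) (snd p) - tree_height (inv h) (snd q)"
        "tree_height (inv h) (snd q) - tree_height (inv h) (snd r)"]
    by simp
  moreover have "\<exists>l. string_length (square_dist F S) (Vertex g, Vertex h) (Vertex x, Vertex y) l"
    using edge_string_exists[OF assms] string_length_mono edge_dist_imp_square_dist by metis
  ultimately have "D (Vertex g, Vertex h) (Vertex x, Vertex y)
      \<le> piecewise_euclidean_metric F S (Vertex g, Vertex h) (Vertex x, Vertex y)"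
    unfolding piecewise_euclidean_metric_def
    by (intro length_metric_ge) (auto simp: D_def)
  then show ?thesis
    using assms by (simp add: D_def)
qed

section \<open>Growth of quotients of the product\<close>

lemma group_product: "group (F \<times>\<times> F)"
  by (intro DirProd_group is_group)

lemma normal_product:
  assumes "N \<lhd> F \<times>\<times> F"
  shows normal_product_one: "(\<one>, \<one>) \<in> N"
    and normal_product_closed: "(x, y) \<in> N \<Longrightarrow> x \<in> carrier F \<and> y \<in> carrier F"
    and normal_product_mult: "(x, y) \<in> N \<Longrightarrow> (x', y') \<in> N \<Longrightarrow> (x \<otimes> x', y \<otimes> y') \<in> N"
    and normal_product_inv: "(x, y) \<in> N \<Longrightarrow> (inv x, inv y) \<in> N"
    and normal_product_conj:
      "(x, y) \<in> N \<Longrightarrow> g \<in> carrier F \<Longrightarrow> h \<in> carrier F \<Longrightarrow>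
         (g \<otimes> x \<otimes> inv g, h \<otimes> y \<otimes> inv h) \<in> N"
proof -
  have sub: "subgroup N (F \<times>\<times> F)"
    using assms by (rule normal_imp_subgroup)
  show "(\<one>, \<one>) \<in> N"
    using subgroup.one_closed[OF sub] by simp
  show closed: "x \<in> carrier F \<and> y \<in> carrier F" if "(x, y) \<in> N" for x y
    using subgroup.subset[OF sub] that by auto
  show "(x \<otimes> x', y \<otimes> y') \<in> N" if "(x, y) \<in> N" "(x', y') \<in> N"
    using subgroup.m_closed[OF sub that] by simp
  show "(inv x, inv y) \<in> N" if "(x, y) \<in> N"
    using subgroup.m_inv_closed[OF sub that] closed[OF that] by (simp add: inv_DirProd is_group)
  show "(g \<otimes> x \<otimes> inv g, h \<otimes> y \<otimes> inv h) \<in> N"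
    if "(x, y) \<in> N" "g \<in> carrier F" "h \<in> carrier F"
    using normal.inv_op_closed2[OF assms _ that(1), of "(g, h)"] that(2,3)
    by (simp add: inv_DirProd is_group)
qed

lemma mem_coset_iff:
  assumes "N \<lhd> F \<times>\<times> F" "x \<in> carrier F" "y \<in> carrier F"
  shows "(x', y') \<in> N #>\<^bsub>F \<times>\<times> F\<^esub> (x, y) \<longleftrightarrow>
           x' \<in> carrier F \<and> y' \<in> carrier F \<and> (x' \<otimes> inv x, y' \<otimes> inv y) \<in> N"
proof
    assume "(x', y') \<in> N #>\<^bsub>F \<times>\<times> F\<^esub> (x, y)"
    then obtain n n' where "(n, n') \<in> N" "x' = n \<otimes> x" "y' = n' \<otimes> y"
      by (auto simp: r_coset_def)
    then show "x' \<in> carrier F \<and> y' \<in> carrier F \<and> (x' \<otimes> inv x, y' \<otimes> inv y) \<in> N"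
      using normal_product_closed[OF assms(1)] assms(2,3) by (auto simp: m_assoc)
  next
    assume *: "x' \<in> carrier F \<and> y' \<in> carrier F \<and> (x' \<otimes> inv x, y' \<otimes> inv y) \<in> N"
    then have "(x', y') = (x' \<otimes> inv x, y' \<otimes> inv y) \<otimes>\<^bsub>F \<times>\<times> F\<^esub> (x, y)"
      using assms(2,3) by (simp add: m_assoc)
    then show "(x', y') \<in> N #>\<^bsub>F \<times>\<times> F\<^esub> (x, y)"
      using * unfolding r_coset_def by blast
qed

text \<open>The intersection of \<open>N\<close> with the first factor, not its projection; it is
  the kernel of the map from that factor to the quotient by \<open>N\<close>.\<close>

definition fst_kernel :: "('a \<times> 'a) set \<Rightarrow> 'a set" where
  "fst_kernel N = {x. (x, \<one>) \<in> N}"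

definition snd_kernel :: "('a \<times> 'a) set \<Rightarrow> 'a set" where
  "snd_kernel N = {y. (\<one>, y) \<in> N}"

lemma normal_fst_kernel:
  assumes "N \<lhd> F \<times>\<times> F"
  shows "fst_kernel N \<lhd> F"
proof (rule normal_invI)
  show "subgroup (fst_kernel N) F"
    by unfold_locales
      (use normal_product_one[OF assms] normal_product_closed[OF assms]
          normal_product_mult[OF assms, of _ \<one> _ \<one>]
          normal_product_inv[OF assms, of _ \<one>] in \<open>auto simp: fst_kernel_def\<close>)
  show "x \<otimes> h \<otimes> inv x \<in> fst_kernel N" if "x \<in> carrier F" "h \<in> fst_kernel N" for x h
    using normal_product_conj[OF assms, of h \<one> x \<one>] that by (simp add: fst_kernel_def)
qed

lemma normal_snd_kernel:
  assumes "N \<lhd> F \<times>\<times> F"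
  shows "snd_kernel N \<lhd> F"
proof (rule normal_invI)
  show "subgroup (snd_kernel N) F"
    by unfold_locales
      (use normal_product_one[OF assms] normal_product_closed[OF assms]
          normal_product_mult[OF assms, of \<one> _ \<one> _]
          normal_product_inv[OF assms, of \<one> _] in \<open>auto simp: snd_kernel_def\<close>)
  show "x \<otimes> h \<otimes> inv x \<in> snd_kernel N" if "x \<in> carrier F" "h \<in> snd_kernel N" for x h
    using normal_product_conj[OF assms, of \<one> h \<one> x] that by (simp add: snd_kernel_def)
qed

text \<open>
  Since the centre of \<open>F\<close> is trivial, a commutator of a nontrivial element of \<open>N\<close> with an
  element of one of the factors is a nontrivial element of \<open>N\<close> in that factor.
\<close>

lemma kernels_nontrivial:
  assumes "N \<lhd> F \<times>\<times> F" "N \<noteq> {(\<one>, \<one>)}"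
  shows "fst_kernel N \<noteq> {\<one>} \<or> snd_kernel N \<noteq> {\<one>}"
proof -
  obtain a b where ab: "(a, b) \<in> N" "(a, b) \<noteq> (\<one>, \<one>)"
    using assms(2) normal_product_one[OF assms(1)] by force
  then have c: "a \<in> carrier F" "b \<in> carrier F"
    using normal_product_closed[OF assms(1)] by auto
  have inv_ab: "(inv a, inv b) \<in> N"
    using normal_product_inv[OF assms(1) ab(1)] .
  have commutator: "a \<otimes> x \<otimes> inv a \<otimes> inv x \<noteq> \<one>"
    if "a \<in> carrier F" "x \<in> carrier F" "a \<otimes> x \<noteq> x \<otimes> a" for a x
    using that by (metis (no_types, lifting) inv_closed inv_inv inv_mult_group inv_equality m_assoc m_closed)
  show ?thesis
  proof (cases "a = \<one>")
    case False
    then obtain x where x: "x \<in> carrier F" "a \<otimes> x \<noteq> x \<otimes> a"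
      using trivial_center c(1) by blast
    \<comment> \<open>Conjugation by \<open>(x, \<one>)\<close> fixes the second entry
      \<open>inv b\<close>, which therefore cancels in the product with
      \<open>(a, b)\<close>.\<close>
    have "(x \<otimes> inv a \<otimes> inv x, inv b) \<in> N"
      using normal_product_conj[OF assms(1) inv_ab x(1) one_closed] c by simp
    from normal_product_mult[OF assms(1) ab(1) this] have "a \<otimes> x \<otimes> inv a \<otimes> inv x \<in> fst_kernel N"
      using c x(1) by (simp add: fst_kernel_def m_assoc)
    then show ?thesis
      using commutator[OF c(1) x] by blast
  next
    case True
    then obtain x where x: "x \<in> carrier F" "b \<otimes> x \<noteq> x \<otimes> b"
      using trivial_center c(2) ab(2) by blast
    have "(inv a, x \<otimes> inv b \<otimes> inv x) \<in> N"
      using normal_product_conj[OF assms(1) inv_ab one_closed x(1)] c by simp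
    from normal_product_mult[OF assms(1) ab(1) this] have "b \<otimes> x \<otimes> inv b \<otimes> inv x \<in> snd_kernel N"
      using c x(1) by (simp add: snd_kernel_def m_assoc)
    then show ?thesis
      using commutator[OF c(2) x] by blast
  qed
qed

text \<open>The coset of \<open>(u x u^-1, v y v^-1)\<close> is no further from \<open>N\<close>
  than \<open>(u, v)\<close> is from \<open>(u x, v y)\<close>, since the identity and this pair are
  representatives. So a ball of radius \<open>t n\<close> contains at least \<open>exp (e n)\<close>
  cosets.\<close>

lemma quotient_growth_ge:
  assumes N: "N \<lhd> F \<times>\<times> F" and uv: "u \<in> carrier F" "v \<in> carrier F"
    and nonneg: "\<And>g h x y. \<lbrakk>g \<in> carrier F; h \<in> carrier F; x \<in> carrier F; y \<in> carrier F\<rbrakk> \<Longrightarrow>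
                   0 \<le> d (Vertex g, Vertex h) (Vertex x, Vertex y)"
    and Z: "\<And>n. Z n \<subseteq> carrier F \<times> carrier F" "\<And>n. finite (Z n)"
      "\<And>n. exp (e * real n) \<le> real (card (Z n))"
      "\<And>n. inj_on (\<lambda>(x, y). N #>\<^bsub>F \<times>\<times> F\<^esub> (u \<otimes> x \<otimes> inv u, v \<otimes> y \<otimes> inv v)) (Z n)"
      "\<And>n x y. (x, y) \<in> Z n \<Longrightarrow>
         d (Vertex u, Vertex v) (Vertex (u \<otimes> x), Vertex (v \<otimes> y)) \<le> t * real n"
    and "t > 0" "e \<ge> 0"
  shows "ereal (e / t) \<le> quotient_growth (F \<times>\<times> F) (product_action F) d (Vertex u, Vertex v) N"
  unfolding quotient_growth_def
proof (rule growth_exponent_ge[where C = e])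
  let ?D = "coset_dist (product_action F) d (Vertex u, Vertex v)"
  let ?c = "\<lambda>(x, y). N #>\<^bsub>F \<times>\<times> F\<^esub> (u \<otimes> x \<otimes> inv u, v \<otimes> y \<otimes> inv v)"
  fix r :: real assume r: "r \<ge> 0"
  \<comment> \<open>The largest \<open>n\<close> with \<open>t * n \<le> r\<close>; rounding loses
    at most one step, hence the constant \<open>C = e\<close>.\<close>
  define n where "n = nat \<lfloor>r / t\<rfloor>"
  have n: "real n \<le> r / t" "r / t - 1 \<le> real n"
    using r \<open>t > 0\<close> unfolding n_def by (auto simp: of_nat_nat)
  have "?D N (?c z) \<le> r" if z: "z \<in> Z n" for z
  proof -
    obtain x y where xy: "z = (x, y)" "x \<in> carrier F" "y \<in> carrier F" "(x, y) \<in> Z n"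
      using z Z(1)[of n] by (cases z) auto
    let ?x = "u \<otimes> x \<otimes> inv u" and ?y = "v \<otimes> y \<otimes> inv v"
    have "?D N (?c z) \<le> d (Vertex u, Vertex v) (Vertex (u \<otimes> x), Vertex (v \<otimes> y))"
      unfolding coset_dist_def
    proof (rule cInf_lower)
      have "(?x, ?y) \<in> ?c z"
        using xy uv mem_coset_iff[OF N, of ?x ?y ?x ?y] normal_product_one[OF N] by simp
      moreover have "d (Vertex u, Vertex v) (Vertex (u \<otimes> x), Vertex (v \<otimes> y)) =
          d (product_action F (\<one>, \<one>) (Vertex u, Vertex v)) (product_action F (?x, ?y) (Vertex u, Vertex v))"
        using xy uv by (simp add: product_action_def m_assoc)
      moreover have "(\<one>, \<one>) \<in> N"
        using normal_product_one[OF N] .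
      ultimately show "d (Vertex u, Vertex v) (Vertex (u \<otimes> x), Vertex (v \<otimes> y)) \<in>
          {d (product_action F c (Vertex u, Vertex v)) (product_action F c' (Vertex u, Vertex v)) |
             c c'. c \<in> N \<and> c' \<in> ?c z}"
        by blast
      have "?c z \<subseteq> carrier F \<times> carrier F"
        using xy uv mem_coset_iff[OF N, of ?x ?y] by auto
      then show "bdd_below {d (product_action F c (Vertex u, Vertex v))
          (product_action F c' (Vertex u, Vertex v)) | c c'. c \<in> N \<and> c' \<in> ?c z}"
        using normal_product_closed[OF N] uv
        by (intro bdd_belowI[of _ 0]) (auto simp: product_action_def intro!: nonneg)
    qed
    also have "\<dots> \<le> t * real n"
      using Z(5) xy(4) by blast
    also have "\<dots> \<le> r"
      using n(1) \<open>t > 0\<close> by (simp add: field_simps)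
    finally show ?thesis .
  qed
  moreover have "?c ` Z n \<subseteq> carrier ((F \<times>\<times> F) Mod N)"
    using Z(1)[of n] uv by (force simp: carrier_FactGroup)
  ultimately have "?c ` Z n \<subseteq> {C \<in> carrier ((F \<times>\<times> F) Mod N). ?D N C \<le> r}"
    by blast
  moreover have "exp (e / t * r - e) \<le> real (card (?c ` Z n))"
  proof -
    have "e / t * r - e \<le> e * real n"
      using mult_left_mono[OF n(2) \<open>e \<ge> 0\<close>] by (simp add: algebra_simps)
    then have "exp (e / t * r - e) \<le> exp (e * real n)" by simp
    also have "\<dots> \<le> real (card (?c ` Z n))"
      using Z(3)[of n] card_image[OF Z(4)[of n]] by simp
    finally show ?thesis .
  qed
  ultimately show "\<exists>X \<subseteq> {C \<in> carrier ((F \<times>\<times> F) Mod N). ?D N C \<le> r}.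
      finite X \<and> exp (e / t * r - e) \<le> real (card X)"
    using Z(2)[of n] by blast
qed

text \<open>Each coset in a ball has a representative whose coordinates can be replaced by elements
  of \<open>X\<close> and \<open>Y\<close> without increasing \<open>\<nu>\<close>. The bounds of
  \<open>\<nu>\<close> from below limit the number of pairs of lengths, and \<open>c\<close> bounds
  the norm of \<open>(a, b)\<close> dual to \<open>\<nu>\<close>.\<close>

lemma quotient_growth_le:
  assumes N: "N \<lhd> F \<times>\<times> F" and uv: "u \<in> carrier F" "v \<in> carrier F"
    and d: "\<And>g h x y. \<lbrakk>g \<in> carrier F; h \<in> carrier F; x \<in> carrier F; y \<in> carrier F\<rbrakk> \<Longrightarrow>
              \<nu> (len (inv g \<otimes> x)) (len (inv h \<otimes> y)) \<le> d (Vertex g, Vertex h) (Vertex x, Vertex y)"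
    and mono: "\<And>i i' j j'. i \<le> i' \<Longrightarrow> j \<le> j' \<Longrightarrow> \<nu> i j \<le> \<nu> i' j'"
    and ge: "\<And>i j. real i \<le> \<nu> i j" "\<And>i j. real j \<le> \<nu> i j"
    and a: "coset_growth_le (fst_kernel N) a" and b: "coset_growth_le (snd_kernel N) b"
    and c: "c \<ge> 0" "\<And>i j. a * real i + b * real j \<le> c * \<nu> i j"
  shows "quotient_growth (F \<times>\<times> F) (product_action F) d (Vertex u, Vertex v) N \<le> ereal c"
proof -
  let ?D = "coset_dist (product_action F) d (Vertex u, Vertex v)"
  let ?c = "\<lambda>(x, y). N #>\<^bsub>F \<times>\<times> F\<^esub> (u \<otimes> x \<otimes> inv u, v \<otimes> y \<otimes> inv v)"
  obtain X K where X: "X \<subseteq> carrier F" "K \<ge> 1"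
    "\<And>n. real (card {x \<in> X. len x = n}) \<le> K * exp (a * real n)"
    "\<And>g. g \<in> carrier F \<Longrightarrow> \<exists>x \<in> X. len x \<le> len g \<and> x \<otimes> inv g \<in> fst_kernel N"
    using a unfolding coset_growth_le_def by blast
  obtain Y L where Y: "Y \<subseteq> carrier F" "L \<ge> 1"
    "\<And>n. real (card {x \<in> Y. len x = n}) \<le> L * exp (b * real n)"
    "\<And>g. g \<in> carrier F \<Longrightarrow> \<exists>x \<in> Y. len x \<le> len g \<and> x \<otimes> inv g \<in> snd_kernel N"
    using b unfolding coset_growth_le_def by blast
  define XY where "XY = (\<lambda>(i, j). {x \<in> X. len x = i} \<times> {y \<in> Y. len y = j})"
  have fin_XY: "finite (XY ij)" for ij
  proof -
    have "XY ij \<subseteq> {g \<in> carrier F. len g = fst ij} \<times> {g \<in> carrier F. len g = snd ij}"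
      using X(1) Y(1) by (auto simp: XY_def)
    then show ?thesis
      using finite_subset finite_cartesian_product[OF finite_len_eq finite_len_eq] by blast
  qed
  have representative: "\<exists>x \<in> X. \<exists>y \<in> Y. \<nu> (len x) (len y) \<le> r + 1 \<and> C = ?c (x, y)"
    if C: "C \<in> carrier ((F \<times>\<times> F) Mod N)" "?D N C \<le> r" for C r
  proof -
    obtain p q where pq: "p \<in> carrier F" "q \<in> carrier F" "C = N #>\<^bsub>F \<times>\<times> F\<^esub> (p, q)"
      using C(1) by (auto simp: carrier_FactGroup)
    have mem_C: "(x, y) \<in> C \<longleftrightarrow> x \<in> carrier F \<and> y \<in> carrier F \<and> (x \<otimes> inv p, y \<otimes> inv q) \<in> N" for x y
      unfolding pq(3) by (rule mem_coset_iff[OF N pq(1,2)])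
    have "(p, q) \<in> C"
      unfolding mem_C using pq normal_product_one[OF N] by simp
    moreover have "(\<one>, \<one>) \<in> N"
      using normal_product_one[OF N] .
    ultimately have "{d (product_action F c (Vertex u, Vertex v)) (product_action F c' (Vertex u, Vertex v)) |
        c c'. c \<in> N \<and> c' \<in> C} \<noteq> {}"
      by blast
    \<comment> \<open>The infimum is not shown to be attained; the slack of 1 disappears in the
      exponent.\<close>
    from cInf_lessD[OF this, of "r + 1"] obtain n c where
      nc: "n \<in> N" "c \<in> C" "d (product_action F n (Vertex u, Vertex v)) (product_action F c (Vertex u, Vertex v)) < r + 1"
      using C(2) unfolding coset_dist_def by auto
    obtain n1 n2 c1 c2 where eqs: "n = (n1, n2)" "c = (c1, c2)" by fastforce
    have nF: "n1 \<in> carrier F" "n2 \<in> carrier F" and cF: "c1 \<in> carrier F" "c2 \<in> carrier F"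
      using nc(1,2) normal_product_closed[OF N, of n1 n2] eqs mem_C by auto
    \<comment> \<open>Translating by \<open>n^-1\<close> moves the first vertex back to the base
      vertex; \<open>x\<close> and \<open>y\<close> are the displacements from there, so
      \<open>u x u^-1 = n1^-1 c1\<close> and \<open>v y v^-1 = n2^-1 c2\<close>.\<close>
    define x y where "x = inv u \<otimes> (inv n1 \<otimes> c1) \<otimes> u" and "y = inv v \<otimes> (inv n2 \<otimes> c2) \<otimes> v"
    have xyF: "x \<in> carrier F" "y \<in> carrier F"
      using uv nF cF by (simp_all add: x_def y_def)
    have "\<nu> (len x) (len y) = \<nu> (len (inv (n1 \<otimes> u) \<otimes> (c1 \<otimes> u))) (len (inv (n2 \<otimes> v) \<otimes> (c2 \<otimes> v)))"
      using uv nF cF by (simp add: x_def y_def inv_mult_group m_assoc)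
    also have "\<dots> \<le> d (Vertex (n1 \<otimes> u), Vertex (n2 \<otimes> v)) (Vertex (c1 \<otimes> u), Vertex (c2 \<otimes> v))"
      using uv nF cF by (intro d) auto
    also have "\<dots> \<le> r + 1"
      using nc(3) by (simp add: eqs product_action_def)
    finally have le: "\<nu> (len x) (len y) \<le> r + 1" .
    obtain x' where x': "x' \<in> X" "len x' \<le> len x" "x' \<otimes> inv x \<in> fst_kernel N"
      using X(4)[OF xyF(1)] by blast
    obtain y' where y': "y' \<in> Y" "len y' \<le> len y" "y' \<otimes> inv y \<in> snd_kernel N"
      using Y(4)[OF xyF(2)] by blast
    have x'y'F: "x' \<in> carrier F" "y' \<in> carrier F"
      using x'(1) y'(1) X(1) Y(1) by auto
    \<comment> \<open>For \<open>w = u\<close>, \<open>z = x'\<close> and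
      \<open>k = u x u^-1\<close>: left multiplication by the conjugate of \<open>x' x^-1\<close>
      turns \<open>u x u^-1\<close> into \<open>u x' u^-1\<close>, so the coset stays the
      same.\<close>
    have cancel: "w \<otimes> (z \<otimes> inv (inv w \<otimes> k \<otimes> w)) \<otimes> inv w \<otimes> k = w \<otimes> z \<otimes> inv w"
      if "w \<in> carrier F" "z \<in> carrier F" "k \<in> carrier F" for w z k
    proof -
      have "w \<otimes> (z \<otimes> inv (inv w \<otimes> k \<otimes> w)) \<otimes> inv w \<otimes> k
          = w \<otimes> z \<otimes> inv w \<otimes> (inv k \<otimes> (w \<otimes> inv w) \<otimes> k)"
        using that by (simp only: inv_mult_group inv_inv m_assoc inv_closed m_closed)
      then show ?thesis
        using that by (simp add: m_assoc)
    qed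
    have "(u \<otimes> (x' \<otimes> inv x) \<otimes> inv u, v \<otimes> (y' \<otimes> inv y) \<otimes> inv v) \<in> N"
    proof -
      have "(u \<otimes> (x' \<otimes> inv x) \<otimes> inv u, \<one>) \<in> N"
        using normal.inv_op_closed2[OF normal_fst_kernel[OF N] uv(1) x'(3)] by (simp add: fst_kernel_def)
      moreover have "(\<one>, v \<otimes> (y' \<otimes> inv y) \<otimes> inv v) \<in> N"
        using normal.inv_op_closed2[OF normal_snd_kernel[OF N] uv(2) y'(3)] by (simp add: snd_kernel_def)
      ultimately show ?thesis
        using normal_product_mult[OF N, of "u \<otimes> (x' \<otimes> inv x) \<otimes> inv u" \<one> \<one> "v \<otimes> (y' \<otimes> inv y) \<otimes> inv v"]
          uv xyF x'y'F by simp
    qed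
    moreover have "(inv n1 \<otimes> c1, inv n2 \<otimes> c2) \<in> C"
      using normal_product_mult[OF N normal_product_inv[OF N], of n1 n2 "c1 \<otimes> inv p" "c2 \<otimes> inv q"]
        nc(1,2) nF cF pq(1,2) by (simp add: mem_C eqs m_assoc)
    ultimately have "(u \<otimes> (x' \<otimes> inv x) \<otimes> inv u \<otimes> (inv n1 \<otimes> c1), v \<otimes> (y' \<otimes> inv y) \<otimes> inv v \<otimes> (inv n2 \<otimes> c2)) \<in> C"
      using normal_product_mult[OF N, of "u \<otimes> (x' \<otimes> inv x) \<otimes> inv u" "v \<otimes> (y' \<otimes> inv y) \<otimes> inv v"
          "inv n1 \<otimes> c1 \<otimes> inv p" "inv n2 \<otimes> c2 \<otimes> inv q"] uv xyF x'y'F nF cF pq(1,2)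
      by (simp add: mem_C m_assoc)
    then have "(u \<otimes> x' \<otimes> inv u, v \<otimes> y' \<otimes> inv v) \<in> C"
      using cancel[OF uv(1) x'y'F(1), of "inv n1 \<otimes> c1"] cancel[OF uv(2) x'y'F(2), of "inv n2 \<otimes> c2"] nF cF
      by (simp only: x_def y_def m_closed inv_closed)
    then have "C = ?c (x', y')"
      using group.repr_independence[OF group_product, of "(u \<otimes> x' \<otimes> inv u, v \<otimes> y' \<otimes> inv v)" N "(p, q)"]
        pq normal_imp_subgroup[OF N] by simp
    moreover have "\<nu> (len x') (len y') \<le> r + 1"
      using mono[OF x'(2) y'(2)] le by linarith
    ultimately show ?thesis
      using x'(1) y'(1) by blast
  qed
  show ?thesis
    unfolding quotient_growth_def
  proof (rule growth_exponent_le[where K = "K * L"])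
    fix r :: real assume r: "r \<ge> 0"
    define I where "I = {(i, j). \<nu> i j \<le> r + 1}"
    \<comment> \<open>All lengths involved are at most \<open>R\<close>, so at most
      \<open>(R + 1)\<^sup>2 \<le> (r + 2)\<^sup>2\<close> pairs of lengths occur.\<close>
    define R where "R = nat \<lfloor>r + 1\<rfloor>"
    have I_sub: "I \<subseteq> {..R} \<times> {..R}"
    proof
      fix ij assume "ij \<in> I"
      then obtain i j where "ij = (i, j)" "\<nu> i j \<le> r + 1" by (auto simp: I_def)
      then have "ij = (i, j)" "real i \<le> r + 1" "real j \<le> r + 1"
        using order_trans[OF ge(1)[of i j]] order_trans[OF ge(2)[where i = i and j = j]] by auto
      then show "ij \<in> {..R} \<times> {..R}"
        unfolding R_def by (simp only: mem_Times_iff atMost_iff fst_conv snd_conv le_nat_floor)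
    qed
    then have fin_I: "finite I"
      by (rule finite_subset) simp
    have "card I \<le> card ({..R} \<times> {..R})"
      by (rule card_mono[OF _ I_sub]) simp
    then have "real (card I) \<le> real (Suc R * Suc R)"
      by (simp only: of_nat_le_iff card_cartesian_product card_atMost)
    also have "\<dots> = (real R + 1)\<^sup>2"
      by (simp add: power2_eq_square algebra_simps)
    also have "\<dots> \<le> (r + 2)\<^sup>2"
      using r by (intro power_mono) (auto simp: R_def)
    finally have card_I: "real (card I) \<le> (r + 2)\<^sup>2" .
    have sub: "{C \<in> carrier ((F \<times>\<times> F) Mod N). ?D N C \<le> r} \<subseteq> ?c ` (\<Union>ij \<in> I. XY ij)"
    proof
      fix C assume "C \<in> {C \<in> carrier ((F \<times>\<times> F) Mod N). ?D N C \<le> r}"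
      then obtain x y where "x \<in> X" "y \<in> Y" "\<nu> (len x) (len y) \<le> r + 1" "C = ?c (x, y)"
        using representative by blast
      then show "C \<in> ?c ` (\<Union>ij \<in> I. XY ij)"
        by (intro image_eqI[of _ _ "(x, y)"]) (auto simp: I_def XY_def)
    qed
    have fin: "finite (\<Union>ij \<in> I. XY ij)"
      using fin_I fin_XY by blast
    have "card {C \<in> carrier ((F \<times>\<times> F) Mod N). ?D N C \<le> r} \<le> card (\<Union>ij \<in> I. XY ij)"
      by (rule order_trans[OF card_mono[OF finite_imageI[OF fin] sub] card_image_le[OF fin]])
    also have "\<dots> \<le> (\<Sum>ij \<in> I. card (XY ij))"
      by (rule card_UN_le[OF fin_I])
    finally have "real (card {C \<in> carrier ((F \<times>\<times> F) Mod N). ?D N C \<le> r}) \<le> (\<Sum>ij \<in> I. real (card (XY ij)))"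
      by (simp only: of_nat_le_iff flip: of_nat_sum)
    also have "\<dots> \<le> (\<Sum>ij \<in> I. K * L * exp (c * (r + 1)))"
    proof (rule sum_mono)
      fix ij assume "ij \<in> I"
      then obtain i j where ij: "ij = (i, j)" "\<nu> i j \<le> r + 1" by (auto simp: I_def)
      have "real (card (XY ij)) \<le> (K * exp (a * real i)) * (L * exp (b * real j))"
        unfolding ij(1) XY_def prod.case card_cartesian_product of_nat_mult
        using X(2,3) Y(3) by (intro mult_mono) auto
      also have "\<dots> = K * L * exp (a * real i + b * real j)"
        by (simp add: exp_add)
      also have "\<dots> \<le> K * L * exp (c * (r + 1))"
      proof -
        have "a * real i + b * real j \<le> c * (r + 1)"
          using c(2)[of i j] mult_left_mono[OF ij(2) c(1)] by linarith
        then show ?thesis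
          using X(2) Y(2) by (intro mult_left_mono) auto
      qed
      finally show "real (card (XY ij)) \<le> K * L * exp (c * (r + 1))" .
    qed
    also have "\<dots> = real (card I) * (K * L * exp (c * (r + 1)))"
      by simp
    also have "\<dots> \<le> (r + 2)\<^sup>2 * (K * L * exp (c * (r + 1)))"
      using card_I X(2) Y(2) by (intro mult_right_mono) auto
    finally show "finite {C \<in> carrier ((F \<times>\<times> F) Mod N). ?D N C \<le> r} \<and>
        real (card {C \<in> carrier ((F \<times>\<times> F) Mod N). ?D N C \<le> r})
          \<le> K * L * (r + 2)\<^sup>2 * exp (c * (r + 1))"
      using finite_subset[OF sub finite_imageI[OF fin]] by (simp add: ac_simps)
  next
    show "K * L \<ge> 1"
      using mult_mono[OF X(2) Y(2)] X(2) by simp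
  qed (rule c(1))
qed

section \<open>The two metrics compared\<close>

lemma inj_on_trivial_cosets:
  assumes "Z \<subseteq> carrier F \<times> carrier F" "u \<in> carrier F" "v \<in> carrier F"
  shows "inj_on (\<lambda>(x, y). {\<one>\<^bsub>F \<times>\<times> F\<^esub>} #>\<^bsub>F \<times>\<times> F\<^esub> (u \<otimes> x \<otimes> inv u, v \<otimes> y \<otimes> inv v)) Z"
  using assms by (intro inj_onI) (auto simp: r_coset_def subset_iff)

text \<open>At least \<open>q ^ (2 * n)\<close> pairs have both lengths equal to \<open>n\<close>,
  and diagonal strings reach them within \<open>sqrt 2 * n\<close>; this gives
  \<open>2 / sqrt 2\<close> times \<open>ln q\<close>.\<close>

lemma quotient_growth_euclidean_trivial:
  assumes "u \<in> carrier F" "v \<in> carrier F"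
  shows "ereal (sqrt 2 * growth) \<le> quotient_growth (F \<times>\<times> F) (product_action F)
           (piecewise_euclidean_metric F S) (Vertex u, Vertex v) {\<one>\<^bsub>F \<times>\<times> F\<^esub>}"
proof -
  define Z where "Z = (\<lambda>n. {x \<in> carrier F. len x = n} \<times> {y \<in> carrier F. len y = n})"
  have Z: "Z n \<subseteq> carrier F \<times> carrier F" for n
    by (auto simp: Z_def)
  have "ereal (2 * growth / sqrt 2) \<le> quotient_growth (F \<times>\<times> F) (product_action F)
      (piecewise_euclidean_metric F S) (Vertex u, Vertex v) {\<one>\<^bsub>F \<times>\<times> F\<^esub>}"
  proof (rule quotient_growth_ge[where Z = Z])
    show "0 \<le> piecewise_euclidean_metric F S (Vertex g, Vertex h) (Vertex x, Vertex y)"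
      if "g \<in> carrier F" "h \<in> carrier F" "x \<in> carrier F" "y \<in> carrier F" for g h x y
      using piecewise_euclidean_metric_ge[OF that] by (rule order_trans[rotated]) simp
    show "exp (2 * growth * real n) \<le> real (card (Z n))" for n
    proof -
      have "exp (2 * growth * real n) = exp (growth * real n) * exp (growth * real n)"
        by (simp flip: exp_add)
      also have "\<dots> \<le> real (card (Z n))"
        unfolding Z_def card_cartesian_product of_nat_mult
        by (intro mult_mono card_len_eq_ge) auto
      finally show ?thesis .
    qed
    show "piecewise_euclidean_metric F S (Vertex u, Vertex v) (Vertex (u \<otimes> x), Vertex (v \<otimes> y))
        \<le> sqrt 2 * real n" if "(x, y) \<in> Z n" for n x y
      using piecewise_euclidean_metric_le[of u v x y] assms that by (auto simp: Z_def)
    show "{\<one>\<^bsub>F \<times>\<times> F\<^esub>} \<lhd> F \<times>\<times> F"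
      by (rule group.one_is_normal[OF group_product])
  qed (use assms growth_pos Z in \<open>auto simp: Z_def finite_len_eq intro!: inj_on_trivial_cosets simp del: one_DirProd\<close>)
  moreover have "2 * growth / sqrt 2 = sqrt 2 * growth"
    by (simp add: real_div_sqrt field_simps)
  ultimately show ?thesis by simp
qed

lemma quotient_growth_euclidean_less:
  assumes N: "N \<lhd> F \<times>\<times> F" "infinite N" and uv: "u \<in> carrier F" "v \<in> carrier F"
  shows "quotient_growth (F \<times>\<times> F) (product_action F)
           (piecewise_euclidean_metric F S) (Vertex u, Vertex v) N < ereal (sqrt 2 * growth)"
proof -
  have M: "fst_kernel N \<lhd> F" "snd_kernel N \<lhd> F"
    using N(1) by (rule normal_fst_kernel, rule normal_snd_kernel)
  have one: "\<one> \<in> fst_kernel N" "\<one> \<in> snd_kernel N"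
    using normal_product_one[OF N(1)] by (simp_all add: fst_kernel_def snd_kernel_def)
  have "N \<noteq> {(\<one>, \<one>)}"
    using N(2) by auto
  then have "fst_kernel N \<noteq> {\<one>} \<or> snd_kernel N \<noteq> {\<one>}"
    using kernels_nontrivial N(1) by blast
  then obtain a b where ab: "coset_growth_le (fst_kernel N) a" "coset_growth_le (snd_kernel N) b"
    "a \<ge> 0" "b \<ge> 0" "a \<le> growth" "b \<le> growth" "a < growth \<or> b < growth"
    using coset_growth_le_less[OF M(1)] coset_growth_le_less[OF M(2)]
      coset_growth_le_growth[OF one(1)] coset_growth_le_growth[OF one(2)] growth_pos
    by (metis less_eq_real_def)
  have "quotient_growth (F \<times>\<times> F) (product_action F)
      (piecewise_euclidean_metric F S) (Vertex u, Vertex v) N \<le> ereal (sqrt (a\<^sup>2 + b\<^sup>2))"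
  proof (rule quotient_growth_le[OF N(1) uv _ _ _ _ ab(1,2),
        where \<nu> = "\<lambda>i j. sqrt ((real i)\<^sup>2 + (real j)\<^sup>2)"])
    show "a * real i + b * real j \<le> sqrt (a\<^sup>2 + b\<^sup>2) * sqrt ((real i)\<^sup>2 + (real j)\<^sup>2)" for i j
    proof -
      \<comment> \<open>The gap in the Cauchy-Schwarz inequality is exactly this square.\<close>
      have "0 \<le> (a * real j - b * real i)\<^sup>2" by simp
      then have "(a * real i + b * real j)\<^sup>2 \<le> (a\<^sup>2 + b\<^sup>2) * ((real i)\<^sup>2 + (real j)\<^sup>2)"
        by (simp add: power2_eq_square algebra_simps)
      then show ?thesis
        unfolding real_sqrt_mult[symmetric] by (rule real_le_rsqrt)
    qed
  qed (auto intro!: piecewise_euclidean_metric_ge real_sqrt_le_mono add_mono power_mono)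
  also have "sqrt (a\<^sup>2 + b\<^sup>2) < sqrt 2 * growth"
  proof -
    have "a\<^sup>2 \<le> growth\<^sup>2" "b\<^sup>2 \<le> growth\<^sup>2" "a\<^sup>2 < growth\<^sup>2 \<or> b\<^sup>2 < growth\<^sup>2"
      using ab(3-7) by (auto intro: power_mono power_strict_mono)
    then have "sqrt (a\<^sup>2 + b\<^sup>2) < sqrt (2 * growth\<^sup>2)"
      by (intro real_sqrt_less_mono) linarith
    then show ?thesis
      using growth_pos by (simp add: real_sqrt_mult)
  qed
  finally show ?thesis by simp
qed

lemma growth_tight_euclidean:
  assumes "u \<in> carrier F" "v \<in> carrier F"
  shows "growth_tight (F \<times>\<times> F) (product_action F)
           (piecewise_euclidean_metric F S) (Vertex u, Vertex v)"
  unfolding growth_tight_def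
  using quotient_growth_euclidean_trivial[OF assms] quotient_growth_euclidean_less[OF _ _ assms]
  by (meson less_le_trans)

text \<open>Every pair of lengths with sum at most \<open>r\<close> contributes at most a constant
  times \<open>exp (growth * r)\<close>, and the number of such pairs is polynomial.\<close>

lemma quotient_growth_skeleton_trivial:
  assumes "u \<in> carrier F" "v \<in> carrier F"
  shows "quotient_growth (F \<times>\<times> F) (product_action F)
           (one_skeleton_metric F S) (Vertex u, Vertex v) {\<one>\<^bsub>F \<times>\<times> F\<^esub>} \<le> ereal growth"
proof -
  have N: "{\<one>\<^bsub>F \<times>\<times> F\<^esub>} \<lhd> F \<times>\<times> F"
    by (rule group.one_is_normal[OF group_product])
  have "coset_growth_le (fst_kernel {\<one>\<^bsub>F \<times>\<times> F\<^esub>}) growth"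
    "coset_growth_le (snd_kernel {\<one>\<^bsub>F \<times>\<times> F\<^esub>}) growth"
    by (auto intro!: coset_growth_le_growth simp: fst_kernel_def snd_kernel_def)
  then show ?thesis
    using growth_pos assms
    by (intro quotient_growth_le[OF N, where \<nu> = "\<lambda>i j. real i + real j"])
      (auto intro: one_skeleton_metric_ge simp: distrib_left)
qed

text \<open>A coset of \<open>{\<one>} \<times> carrier F\<close> is determined by its first
  coordinate, so a sphere of the first factor yields distinct cosets.\<close>

lemma quotient_growth_skeleton_factor:
  assumes N: "{\<one>} \<times> carrier F \<lhd> F \<times>\<times> F" and uv: "u \<in> carrier F" "v \<in> carrier F"
  shows "ereal growth \<le> quotient_growth (F \<times>\<times> F) (product_action F)
           (one_skeleton_metric F S) (Vertex u, Vertex v) ({\<one>} \<times> carrier F)"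
proof -
  define Z where "Z = (\<lambda>n. {x \<in> carrier F. len x = n} \<times> {\<one>})"
  have "ereal (growth / 1) \<le> quotient_growth (F \<times>\<times> F) (product_action F)
      (one_skeleton_metric F S) (Vertex u, Vertex v) ({\<one>} \<times> carrier F)"
  proof (rule quotient_growth_ge[OF N uv, where Z = Z])
    show "0 \<le> one_skeleton_metric F S (Vertex g, Vertex h) (Vertex x, Vertex y)"
      if "g \<in> carrier F" "h \<in> carrier F" "x \<in> carrier F" "y \<in> carrier F" for g h x y
      using one_skeleton_metric_ge[OF that] by (rule order_trans[rotated]) simp
    show "exp (growth * real n) \<le> real (card (Z n))" for n
      using card_len_eq_ge[of n] by (simp add: Z_def card_cartesian_product)
    show "inj_on (\<lambda>(x, y). ({\<one>} \<times> carrier F) #>\<^bsub>F \<times>\<times> F\<^esub> (u \<otimes> x \<otimes> inv u, v \<otimes> y \<otimes> inv v)) (Z n)" for n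
    proof (rule inj_onI)
      let ?c = "\<lambda>(x, y). ({\<one>} \<times> carrier F) #>\<^bsub>F \<times>\<times> F\<^esub> (u \<otimes> x \<otimes> inv u, v \<otimes> y \<otimes> inv v)"
      fix z z' assume "z \<in> Z n" "z' \<in> Z n" and cosets: "?c z = ?c z'"
      then obtain x x' where x: "x \<in> carrier F" "x' \<in> carrier F" and z: "z = (x, \<one>)" "z' = (x', \<one>)"
        by (auto simp: Z_def)
      have eq: "({\<one>} \<times> carrier F) #>\<^bsub>F \<times>\<times> F\<^esub> (u \<otimes> x \<otimes> inv u, v \<otimes> \<one> \<otimes> inv v) =
                ({\<one>} \<times> carrier F) #>\<^bsub>F \<times>\<times> F\<^esub> (u \<otimes> x' \<otimes> inv u, v \<otimes> \<one> \<otimes> inv v)"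
        using cosets by (simp only: z prod.case)
      have "(u \<otimes> x \<otimes> inv u, \<one>) \<in> ({\<one>} \<times> carrier F) #>\<^bsub>F \<times>\<times> F\<^esub> (u \<otimes> x \<otimes> inv u, v \<otimes> \<one> \<otimes> inv v)"
        using x uv by (simp add: mem_coset_iff[OF N])
      then have "u \<otimes> x \<otimes> inv u = u \<otimes> x' \<otimes> inv u"
        using x uv unfolding eq by (simp add: r_coset_def)
      then show "z = z'"
        using x uv z by simp
    qed
    show "one_skeleton_metric F S (Vertex u, Vertex v) (Vertex (u \<otimes> x), Vertex (v \<otimes> y)) \<le> 1 * real n"
      if "(x, y) \<in> Z n" for n x y
      using one_skeleton_metric_le[of u v x y] uv that by (auto simp: Z_def)
  qed (use growth_pos in \<open>auto simp: Z_def finite_len_eq\<close>)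
  then show ?thesis by simp
qed

lemma not_growth_tight_skeleton:
  assumes "u \<in> carrier F" "v \<in> carrier F"
  shows "\<not> growth_tight (F \<times>\<times> F) (product_action F)
           (one_skeleton_metric F S) (Vertex u, Vertex v)"
proof -
  have N: "{\<one>} \<times> carrier F \<lhd> F \<times>\<times> F"
  proof (rule group.normal_invI[OF group_product])
    show "subgroup ({\<one>} \<times> carrier F) (F \<times>\<times> F)"
      by (intro DirProd_subgroups is_group triv_subgroup subgroup_self)
  qed (auto simp: inv_DirProd is_group)
  have "infinite ({\<one>} \<times> carrier F)"
    using infinite_carrier finite_cartesian_productD2 by blast
  with N show ?thesis
    unfolding growth_tight_def
    using order_trans[OF quotient_growth_skeleton_trivial[OF assms] quotient_growth_skeleton_factor[OF N assms]]
    by (meson leD)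
qed

end

theorem corollary1p5:
  fixes F :: "('a, 'm) monoid_scheme" and S :: "'a set" and u v :: 'a
  assumes "free_basis F S" and "finite S" and "\<not> comm_group F"
    and "u \<in> carrier F" and "v \<in> carrier F"
  shows "growth_tight (F \<times>\<times> F) (product_action F)
           (piecewise_euclidean_metric F S) (Vertex u, Vertex v) \<and>
         \<not> growth_tight (F \<times>\<times> F) (product_action F)
           (one_skeleton_metric F S) (Vertex u, Vertex v)"
proof -
  interpret nonabelian_free_group F S
    using assms(1-3) by (simp add: nonabelian_free_group_def nonabelian_free_group_axioms_def free_basis_def)
  show ?thesis
    using growth_tight_euclidean not_growth_tight_skeleton assms(4,5) by blast
qed

end
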